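(* Let $\mathcal{H}$ be the classical Hardy space on the open unit disk $\mathbb{D}$. For any two subsets $A,B\subset\mathbb{D}$ such that $S(A)=A$ and $S(B)=B$, the multiplier algebras $\mathcal{M}_A$ and $\mathcal{M}_B$ are isometrically isomorphic as Banach algebras if and only if $A$ and $B$ are congruent.
   Context: The classical Hardy space $\mathcal{H}$ is the Hilbert function space on $\mathbb{D}$ of power series $\sum a_nz^n$ with $\sum|a_n|^2<\infty$ (inner product $\sum f_n\overline{g_n}$), with kernel functions $k_y(x)=\frac{1}{1-x\overline{y}}$. For $A\subset\mathbb{D}$, $\mathcal{H}_A=\overline{\operatorname{span}\{k_a:a\in A\}}$ with the inner product of $\mathcal{H}$, regarded as a Hilbert function space on $A$ (an element of $\mathcal{H}_A$ is determined by its values on $A$). Its multiplier algebra is $\mathcal{M}_A=\{f\in\mathbb{C}^A: fh\in\mathcal{H}_A\text{ for all }h\in\mathcal{H}_A\}$, a Banach algebra with norm $\|f\|_{\mathcal{M}_A}$ equal to the operator norm of multiplication by $f$ on $\mathcal{H}_A$. $S(A):=\{x\in\mathbb{D}:k_x\in\mathcal{H}_A\}$. Two subsets of $\mathbb{D}$ are congruent if there is a bi-holomorphic automorphism of $\mathbb{D}$ taking one onto the other. *)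

theory Defs
  imports "HOL-Analysis.Analysis"
begin

section \<open>The Hardy space\<close>

lemma square_summable_summable_mult:
  fixes a b :: "nat \<Rightarrow> complex"
  assumes "summable (\<lambda>n. (cmod (a n))\<^sup>2)" "summable (\<lambda>n. (cmod (b n))\<^sup>2)"
  shows "summable (\<lambda>n. a n * cnj (b n))"
proof (rule summable_comparison_test')
  show "summable (\<lambda>n. (cmod (a n))\<^sup>2 + (cmod (b n))\<^sup>2)"
    using assms by (rule summable_add)
  fix n
  have "0 \<le> (cmod (a n) - cmod (b n))\<^sup>2" by simp
  moreover have "0 \<le> cmod (a n) * cmod (b n)" by simp
  ultimately show "norm (a n * cnj (b n)) \<le> (cmod (a n))\<^sup>2 + (cmod (b n))\<^sup>2"
    unfolding norm_mult complex_mod_cnj power2_diff by linarith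
qed

lemma square_summable_add:
  fixes a b :: "nat \<Rightarrow> complex"
  assumes "summable (\<lambda>n. (cmod (a n))\<^sup>2)" "summable (\<lambda>n. (cmod (b n))\<^sup>2)"
  shows "summable (\<lambda>n. (cmod (a n + b n))\<^sup>2)"
proof (rule summable_comparison_test')
  show "summable (\<lambda>n. 2 * (cmod (a n))\<^sup>2 + 2 * (cmod (b n))\<^sup>2)"
    using assms by (intro summable_add summable_mult)
  fix n
  have "(cmod (a n + b n))\<^sup>2 \<le> (cmod (a n) + cmod (b n))\<^sup>2"
    by (intro power_mono norm_triangle_ineq) simp
  also have "\<dots> \<le> 2 * (cmod (a n))\<^sup>2 + 2 * (cmod (b n))\<^sup>2"
    using zero_le_power2[of "cmod (a n) - cmod (b n)"] by (simp add: power2_diff power2_sum)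
  finally show "norm ((cmod (a n + b n))\<^sup>2) \<le> 2 * (cmod (a n))\<^sup>2 + 2 * (cmod (b n))\<^sup>2"
    by simp
qed

lemma square_summable_mult:
  fixes a :: "nat \<Rightarrow> complex"
  assumes "summable (\<lambda>n. (cmod (a n))\<^sup>2)"
  shows "summable (\<lambda>n. (cmod (c * a n))\<^sup>2)"
  using summable_mult[OF assms, of "(cmod c)\<^sup>2"] by (simp add: norm_mult power_mult_distrib)

text \<open>A power series in the Hardy space is represented by its sequence of coefficients.\<close>

typedef hardy = "{a :: nat \<Rightarrow> complex. summable (\<lambda>n. (cmod (a n))\<^sup>2)}"
  morphisms hardy_coeff Abs_hardy
  by (rule exI[of _ "\<lambda>_. 0"]) simp

setup_lifting type_definition_hardy

lemma hardy_eqI: "(\<And>n. hardy_coeff f n = hardy_coeff g n) \<Longrightarrow> f = g"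
  by (simp add: ext flip: hardy_coeff_inject)

lemma summable_hardy_coeff: "summable (\<lambda>n. (cmod (hardy_coeff f n))\<^sup>2)"
  using hardy_coeff[of f] by simp

text \<open>The complex inner product.\<close>

definition hardy_cinner :: "hardy \<Rightarrow> hardy \<Rightarrow> complex"
  where "hardy_cinner f g = (\<Sum>n. hardy_coeff f n * cnj (hardy_coeff g n))"

lift_definition hardy_scale :: "complex \<Rightarrow> hardy \<Rightarrow> hardy"
  is "\<lambda>c a n. c * a n"
  by (rule square_summable_mult)

instantiation hardy :: real_vector
begin

lift_definition zero_hardy :: hardy is "\<lambda>_. 0" by simp

lift_definition plus_hardy :: "hardy \<Rightarrow> hardy \<Rightarrow> hardy" is "\<lambda>a b n. a n + b n"
  by (rule square_summable_add)

lift_definition uminus_hardy :: "hardy \<Rightarrow> hardy" is "\<lambda>a n. - a n" by simp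

definition minus_hardy :: "hardy \<Rightarrow> hardy \<Rightarrow> hardy"
  where "minus_hardy f g = f + - g"

definition scaleR_hardy :: "real \<Rightarrow> hardy \<Rightarrow> hardy"
  where "scaleR_hardy r = hardy_scale (complex_of_real r)"

instance
proof
  fix f g h :: hardy and r s :: real
  show "f + g + h = f + (g + h)" by transfer (simp add: add.assoc)
  show "f + g = g + f" by transfer (simp add: add.commute)
  show "0 + f = f" by transfer simp
  show "- f + f = 0" by transfer simp
  show "f - g = f + - g" by (rule minus_hardy_def)
  show "r *\<^sub>R (f + g) = r *\<^sub>R f + r *\<^sub>R g"
    unfolding scaleR_hardy_def by transfer (simp add: algebra_simps)
  show "(r + s) *\<^sub>R f = r *\<^sub>R f + s *\<^sub>R f"
    unfolding scaleR_hardy_def by transfer (simp add: algebra_simps)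
  show "r *\<^sub>R s *\<^sub>R f = (r * s) *\<^sub>R f"
    unfolding scaleR_hardy_def by transfer (simp add: algebra_simps)
  show "1 *\<^sub>R f = f"
    unfolding scaleR_hardy_def by transfer simp
qed

end

lemma hardy_coeff_add [simp]: "hardy_coeff (f + g) n = hardy_coeff f n + hardy_coeff g n"
  by transfer simp

lemma hardy_coeff_scale [simp]: "hardy_coeff (hardy_scale c f) n = c * hardy_coeff f n"
  by transfer simp

lemma hardy_coeff_zero [simp]: "hardy_coeff 0 n = 0"
  by transfer simp

lemma hardy_coeff_minus [simp]: "hardy_coeff (f - g) n = hardy_coeff f n - hardy_coeff g n"
  unfolding minus_hardy_def by transfer simp

lemma hardy_cinner_summable: "summable (\<lambda>n. hardy_coeff f n * cnj (hardy_coeff g n))"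
  by (intro square_summable_summable_mult summable_hardy_coeff)

lemma hardy_cinner_add: "hardy_cinner (f + g) h = hardy_cinner f h + hardy_cinner g h"
  unfolding hardy_cinner_def
  by (simp add: distrib_right suminf_add hardy_cinner_summable)

lemma hardy_cinner_scale: "hardy_cinner (hardy_scale c f) h = c * hardy_cinner f h"
  unfolding hardy_cinner_def
  by (simp add: mult.assoc suminf_mult hardy_cinner_summable)

lemma hardy_cinner_cnj: "cnj (hardy_cinner f g) = hardy_cinner g f"
proof -
  have "(\<lambda>n. cnj (hardy_coeff f n * cnj (hardy_coeff g n))) sums cnj (hardy_cinner f g)"
    unfolding sums_cnj hardy_cinner_def by (rule summable_sums[OF hardy_cinner_summable])
  then show ?thesis
    unfolding hardy_cinner_def by (simp add: sums_iff mult.commute)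
qed

lemma hardy_cinner_self:
  "hardy_cinner f f = complex_of_real (\<Sum>n. (cmod (hardy_coeff f n))\<^sup>2)"
  unfolding hardy_cinner_def complex_norm_square[symmetric]
  by (rule suminf_of_real[symmetric]) (rule summable_hardy_coeff)

text \<open>The library has no class of complex inner product spaces, so the Hardy space is made an
  instance of \<open>real_inner\<close> through the real part of the complex inner product; this gives the
  same norm.\<close>

instantiation hardy :: real_inner
begin

definition inner_hardy :: "hardy \<Rightarrow> hardy \<Rightarrow> real"
  where "inner_hardy f g = Re (hardy_cinner f g)"

definition norm_hardy :: "hardy \<Rightarrow> real"
  where "norm_hardy f = sqrt (inner f f)"

definition dist_hardy :: "hardy \<Rightarrow> hardy \<Rightarrow> real"
  where "dist_hardy f g = norm (f - g)"

definition sgn_hardy :: "hardy \<Rightarrow> hardy"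
  where "sgn_hardy f = f /\<^sub>R norm f"

definition uniformity_hardy :: "(hardy \<times> hardy) filter"
  where "uniformity_hardy = (INF e\<in>{0 <..}. principal {(x, y). dist x y < e})"

definition open_hardy :: "hardy set \<Rightarrow> bool"
  where "open_hardy U = (\<forall>x\<in>U. eventually (\<lambda>(x', y). x' = x \<longrightarrow> y \<in> U) uniformity)"

instance
proof
  fix f g h :: hardy and r :: real and U :: "hardy set"
  show "dist f g = norm (f - g)" by (rule dist_hardy_def)
  show "sgn f = f /\<^sub>R norm f" by (rule sgn_hardy_def)
  show "uniformity = (INF e\<in>{0 <..}. principal {(x, y :: hardy). dist x y < e})"
    by (rule uniformity_hardy_def)
  show "open U = (\<forall>x\<in>U. eventually (\<lambda>(x', y). x' = x \<longrightarrow> y \<in> U) uniformity)"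
    by (rule open_hardy_def)
  show "inner f g = inner g f"
    unfolding inner_hardy_def by (subst hardy_cinner_cnj[symmetric]) simp
  show "inner (f + g) h = inner f h + inner g h"
    by (simp add: inner_hardy_def hardy_cinner_add)
  show "inner (r *\<^sub>R f) g = r * inner f g"
    by (simp add: inner_hardy_def scaleR_hardy_def hardy_cinner_scale)
  show "0 \<le> inner f f"
    by (simp add: inner_hardy_def hardy_cinner_self suminf_nonneg summable_hardy_coeff)
  show "(inner f f = 0) = (f = 0)"
  proof
    assume "inner f f = 0"
    then have "hardy_coeff f n = 0" for n
      by (simp add: inner_hardy_def hardy_cinner_self suminf_eq_zero_iff summable_hardy_coeff)
    then show "f = 0" by (intro hardy_eqI) simp
  qed (simp add: inner_hardy_def hardy_cinner_def)
  show "norm f = sqrt (inner f f)" by (rule norm_hardy_def)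
qed

end

lemma norm_hardy_eq: "norm f = sqrt (\<Sum>n. (cmod (hardy_coeff f n))\<^sup>2)"
  by (simp add: norm_hardy_def inner_hardy_def hardy_cinner_self)

text \<open>Complex linear spans in the Hardy space are \<open>hardy.span\<close>.\<close>

global_interpretation hardy: vector_space hardy_scale
  by unfold_locales (auto intro!: hardy_eqI simp: algebra_simps)

definition hardy_eval :: "hardy \<Rightarrow> complex \<Rightarrow> complex"
  where "hardy_eval f x = (\<Sum>n. hardy_coeff f n * x ^ n)"

text \<open>The kernel function at \<open>y\<close> is the power series of \<open>1 / (1 - x * cnj y)\<close> in \<open>x\<close>. It belongs
  to the Hardy space only for \<open>y\<close> in the open unit disk.\<close>

definition hardy_kernel :: "complex \<Rightarrow> hardy"
  where "hardy_kernel y = Abs_hardy (\<lambda>n. cnj y ^ n)"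

abbreviation unit_disk :: "complex set"
  where "unit_disk \<equiv> ball 0 1"

lemma hardy_coeff_kernel:
  assumes "y \<in> unit_disk"
  shows "hardy_coeff (hardy_kernel y) n = cnj y ^ n"
proof -
  have "summable (\<lambda>n. ((cmod y)\<^sup>2) ^ n)"
    using assms by (intro summable_geometric) (simp add: power_less_one_iff abs_square_less_1)
  then have "summable (\<lambda>n. (cmod (cnj y ^ n))\<^sup>2)"
    by (simp add: norm_power power_mult[symmetric] mult.commute)
  then show ?thesis
    unfolding hardy_kernel_def by (subst Abs_hardy_inverse) auto
qed

lemma hardy_eval_kernel:
  assumes "x \<in> unit_disk" "y \<in> unit_disk"
  shows "hardy_eval (hardy_kernel y) x = 1 / (1 - x * cnj y)"
proof -
  have "cmod (x * cnj y) < 1"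
    using assms mult_strict_mono'[of "cmod x" 1 "cmod y" 1] by (simp add: norm_mult)
  then have "(\<Sum>n. (x * cnj y) ^ n) = 1 / (1 - x * cnj y)"
    by (rule suminf_geometric)
  then show ?thesis
    using assms by (simp add: hardy_eval_def hardy_coeff_kernel power_mult_distrib mult.commute)
qed

lemma hardy_reproducing:
  assumes "y \<in> unit_disk"
  shows "hardy_cinner f (hardy_kernel y) = hardy_eval f y"
  using assms by (simp add: hardy_eval_def hardy_cinner_def hardy_coeff_kernel)

section \<open>The spaces on subsets of the disk and their multiplier algebras\<close>

definition hardy_sub :: "complex set \<Rightarrow> hardy set"
  where "hardy_sub A = closure (hardy.span (hardy_kernel ` A))"

definition hardy_hull :: "complex set \<Rightarrow> complex set"
  where "hardy_hull A = {x \<in> unit_disk. hardy_kernel x \<in> hardy_sub A}"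

text \<open>Functions on a set \<open>A\<close> are represented as the members of \<open>extensional A\<close>.\<close>

definition hardy_restrict :: "complex set \<Rightarrow> hardy \<Rightarrow> complex \<Rightarrow> complex"
  where "hardy_restrict A f = restrict (hardy_eval f) A"

lemma inj_on_hardy_restrict:
  assumes "A \<subseteq> unit_disk"
  shows "inj_on (hardy_restrict A) (hardy_sub A)"
proof (rule inj_onI)
  fix f g
  assume f: "f \<in> hardy_sub A" and g: "g \<in> hardy_sub A"
    and eq: "hardy_restrict A f = hardy_restrict A g"
  define d where "d = f - g"
  have d: "hardy_cinner (hardy_kernel a) d = 0" if "a \<in> A" for a
  proof -
    have a: "a \<in> unit_disk" using assms that by blast
    have "hardy_eval f a = hardy_eval g a"
      using fun_cong[OF eq, of a] that by (simp add: hardy_restrict_def)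
    moreover have "hardy_cinner f (hardy_kernel a)
        = hardy_cinner d (hardy_kernel a) + hardy_cinner g (hardy_kernel a)"
      by (simp add: d_def flip: hardy_cinner_add)
    ultimately have "hardy_cinner d (hardy_kernel a) = 0"
      using a by (simp add: hardy_reproducing)
    then show ?thesis by (metis hardy_cinner_cnj complex_cnj_zero)
  qed
  have "hardy_cinner v d = 0" if "v \<in> hardy.span (hardy_kernel ` A)" for v
    using that
  proof (induction rule: hardy.span_induct_alt)
    case base
    show ?case by (simp add: hardy_cinner_def)
  next
    case (step c x y)
    then show ?case using d by (auto simp: hardy_cinner_add hardy_cinner_scale)
  qed
  then have "hardy.span (hardy_kernel ` A) \<subseteq> {v. inner d v = 0}"
    by (auto simp: inner_commute[of d]) (simp add: inner_hardy_def)
  then have "hardy_sub A \<subseteq> {v. inner d v = 0}"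
    unfolding hardy_sub_def
    by (intro closure_minimal closed_Collect_eq continuous_intros)
  with f g have "inner d d = 0"
    by (simp add: d_def inner_diff_right subset_iff)
  then show "f = g" by (simp add: d_def)
qed

definition hardy_on :: "complex set \<Rightarrow> (complex \<Rightarrow> complex) set"
  where "hardy_on A = hardy_restrict A ` hardy_sub A"

text \<open>By \<open>inj_on_hardy_restrict\<close>, for \<open>A\<close> in the disk this is the norm of the unique
  element of \<open>hardy_sub A\<close> with the given values on \<open>A\<close>.\<close>

definition hardy_on_norm :: "complex set \<Rightarrow> (complex \<Rightarrow> complex) \<Rightarrow> real"
  where "hardy_on_norm A h = norm (the_inv_into (hardy_sub A) (hardy_restrict A) h)"

definition multipliers :: "complex set \<Rightarrow> (complex \<Rightarrow> complex) set"
  where "multipliers A =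
    {f \<in> extensional A. \<forall>h\<in>hardy_on A. (\<lambda>x\<in>A. f x * h x) \<in> hardy_on A}"

text \<open>The operator norm. For \<open>f \<in> multipliers A\<close> the set is bounded by the closed graph theorem,
  so that the real supremum is the intended one.\<close>

definition multiplier_norm :: "complex set \<Rightarrow> (complex \<Rightarrow> complex) \<Rightarrow> real"
  where "multiplier_norm A f =
    Sup {hardy_on_norm A (\<lambda>x\<in>A. f x * h x) | h. h \<in> hardy_on A \<and> hardy_on_norm A h \<le> 1}"

definition multipliers_isometrically_isomorphic :: "complex set \<Rightarrow> complex set \<Rightarrow> bool"
  where "multipliers_isometrically_isomorphic A B \<longleftrightarrow>
    (\<exists>\<Phi>. bij_betw \<Phi> (multipliers A) (multipliers B)
      \<and> (\<forall>f\<in>multipliers A. \<forall>g\<in>multipliers A.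
            \<Phi> (\<lambda>x\<in>A. f x + g x) = (\<lambda>x\<in>B. \<Phi> f x + \<Phi> g x))
      \<and> (\<forall>c. \<forall>f\<in>multipliers A. \<Phi> (\<lambda>x\<in>A. c * f x) = (\<lambda>x\<in>B. c * \<Phi> f x))
      \<and> (\<forall>f\<in>multipliers A. \<forall>g\<in>multipliers A.
            \<Phi> (\<lambda>x\<in>A. f x * g x) = (\<lambda>x\<in>B. \<Phi> f x * \<Phi> g x))
      \<and> (\<forall>f\<in>multipliers A. multiplier_norm B (\<Phi> f) = multiplier_norm A f))"

definition disk_automorphism :: "(complex \<Rightarrow> complex) \<Rightarrow> bool"
  where "disk_automorphism \<phi> \<longleftrightarrow>
    bij_betw \<phi> unit_disk unit_disk \<and> \<phi> holomorphic_on unit_disk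
    \<and> the_inv_into unit_disk \<phi> holomorphic_on unit_disk"

definition congruent_in_disk :: "complex set \<Rightarrow> complex set \<Rightarrow> bool"
  where "congruent_in_disk A B \<longleftrightarrow> (\<exists>\<phi>. disk_automorphism \<phi> \<and> \<phi> ` A = B)"

end

theory Submission
  imports Defs "HOL-Complex_Analysis.Riemann_Mapping"
begin

text \<open>A function on \<open>A\<close> is the restriction of a Hardy space function of norm at most \<open>r\<close> iff the
  functional it induces on finite combinations of kernel functions is bounded by \<open>r\<close>. In particular
  a multiplier is contractive iff its Pick kernel is positive. An automorphism of the disk changes
  the kernel \<open>1 / (1 - x * cnj y)\<close> only by a factor of the form \<open>u x * cnj (u y)\<close>, so congruent
  sets have isometrically isomorphic multiplier algebras.

  Conversely, let \<open>A\<close> be its own hull and not the whole disk. A function vanishing on \<open>A\<close> is not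
  divisible infinitely often by a Moebius function, hence every \<open>a\<close> in \<open>A\<close> is separated from the
  other points of \<open>A\<close> by a Hardy space function, and the characteristic functions of the points are
  minimal idempotents of the multiplier algebra. For the whole disk there are none. Therefore an
  isomorphism is composition with a bijection \<open>\<alpha>\<close> from \<open>A\<close> to \<open>B\<close>. The Moebius function \<open>m\<close>
  vanishing at \<open>a\<close> is a contractive multiplier, hence so is its image on \<open>B\<close>, which vanishes at
  \<open>\<alpha> a\<close>. By Pick's inequality for two points and symmetry its modulus is that of the Moebius
  function \<open>m'\<close> vanishing at \<open>\<alpha> a\<close>. This is the extremal case, in which positivity for three points
  forces the image of \<open>m\<close> to be a constant multiple of \<open>m'\<close>.\<close>

section \<open>Completeness, Riesz representation and uniform boundedness\<close>

lemma partial_sum_hardy_coeff_le: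
  "(\<Sum>n<N. (cmod (hardy_coeff f n))\<^sup>2) \<le> (norm f)\<^sup>2"
proof -
  have "(\<Sum>n<N. (cmod (hardy_coeff f n))\<^sup>2) \<le> (\<Sum>n. (cmod (hardy_coeff f n))\<^sup>2)"
    by (intro sum_le_suminf summable_hardy_coeff) auto
  also have "\<dots> = (norm f)\<^sup>2"
    by (simp add: norm_hardy_eq suminf_nonneg summable_hardy_coeff)
  finally show ?thesis .
qed

lemma norm_hardy_coeff_le: "cmod (hardy_coeff f n) \<le> norm f"
proof -
  have "(cmod (hardy_coeff f n))\<^sup>2 \<le> (\<Sum>n<Suc n. (cmod (hardy_coeff f n))\<^sup>2)"
    by (simp add: sum_nonneg)
  also have "\<dots> \<le> (norm f)\<^sup>2"
    by (rule partial_sum_hardy_coeff_le)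
  finally show ?thesis
    by (rule power2_le_imp_le) simp
qed

text \<open>A Cauchy sequence converges coefficientwise. Its estimates on finite partial sums
  survive that limit uniformly in the number of terms, which makes the limit square summable and the
  convergence one in norm.\<close>

instance hardy :: complete_space
proof
  fix X :: "nat \<Rightarrow> hardy"
  assume X: "Cauchy X"
  have "Cauchy (\<lambda>k. hardy_coeff (X k) n)" for n
  proof (rule CauchyI)
    fix e :: real assume "0 < e"
    then obtain M where M: "\<And>k l. k \<ge> M \<Longrightarrow> l \<ge> M \<Longrightarrow> norm (X k - X l) < e"
      using CauchyD[OF X] by blast
    show "\<exists>M. \<forall>k\<ge>M. \<forall>l\<ge>M. norm (hardy_coeff (X k) n - hardy_coeff (X l) n) < e"
    proof (intro exI allI impI)
      fix k l assume "M \<le> k" "M \<le> l"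
      then show "norm (hardy_coeff (X k) n - hardy_coeff (X l) n) < e"
        using le_less_trans[OF norm_hardy_coeff_le M] by (metis hardy_coeff_minus)
    qed
  qed
  then have "\<exists>l. (\<lambda>k. hardy_coeff (X k) n) \<longlonglongrightarrow> l" for n
    using Cauchy_convergent convergent_def by blast
  then obtain a where a: "\<And>n. (\<lambda>k. hardy_coeff (X k) n) \<longlonglongrightarrow> a n"
    by metis
  have bound: "\<exists>M. \<forall>k\<ge>M. \<forall>N. (\<Sum>n<N. (cmod (hardy_coeff (X k) n - a n))\<^sup>2) \<le> e\<^sup>2"
    if e: "0 < e" for e :: real
  proof -
    obtain M where M: "\<And>k l. k \<ge> M \<Longrightarrow> l \<ge> M \<Longrightarrow> norm (X k - X l) < e"
      using CauchyD[OF X e] by blast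
    have "(\<Sum>n<N. (cmod (hardy_coeff (X k) n - a n))\<^sup>2) \<le> e\<^sup>2" if "k \<ge> M" for k N
    proof (rule LIMSEQ_le_const2)
      show "(\<lambda>l. \<Sum>n<N. (cmod (hardy_coeff (X k) n - hardy_coeff (X l) n))\<^sup>2)
          \<longlonglongrightarrow> (\<Sum>n<N. (cmod (hardy_coeff (X k) n - a n))\<^sup>2)"
        by (intro tendsto_intros a)
      show "\<exists>L. \<forall>l\<ge>L. (\<Sum>n<N. (cmod (hardy_coeff (X k) n - hardy_coeff (X l) n))\<^sup>2) \<le> e\<^sup>2"
      proof (intro exI allI impI)
        fix l assume "M \<le> l"
        have "(\<Sum>n<N. (cmod (hardy_coeff (X k - X l) n))\<^sup>2) \<le> (norm (X k - X l))\<^sup>2"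
          by (rule partial_sum_hardy_coeff_le)
        also have "\<dots> \<le> e\<^sup>2"
          using M[OF \<open>k \<ge> M\<close> \<open>M \<le> l\<close>] by (intro power_mono) auto
        finally show "(\<Sum>n<N. (cmod (hardy_coeff (X k) n - hardy_coeff (X l) n))\<^sup>2) \<le> e\<^sup>2"
          by simp
      qed
    qed
    then show ?thesis by blast
  qed
  have summ: "summable (\<lambda>n. (cmod (hardy_coeff (X k) n - a n))\<^sup>2)"
    if "\<forall>N. (\<Sum>n<N. (cmod (hardy_coeff (X k) n - a n))\<^sup>2) \<le> e\<^sup>2" for k e
    using that by (intro summableI_nonneg_bounded) auto
  obtain k where "\<forall>N. (\<Sum>n<N. (cmod (hardy_coeff (X k) n - a n))\<^sup>2) \<le> 1\<^sup>2"
    using bound[of 1] by auto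
  then have k: "summable (\<lambda>n. (cmod (hardy_coeff (X k) n - a n))\<^sup>2)"
    by (rule summ)
  \<comment> \<open>The limit \<open>a\<close> is written as \<open>X k\<close> minus a square
    summable difference.\<close>
  have "summable (\<lambda>n. (cmod (hardy_coeff (X k) n + (-1) * (hardy_coeff (X k) n - a n)))\<^sup>2)"
    by (intro square_summable_add square_summable_mult k summable_hardy_coeff)
  then have "summable (\<lambda>n. (cmod (a n))\<^sup>2)"
    by simp
  then obtain f where f: "hardy_coeff f = a"
    using Abs_hardy_inverse[of a] by auto
  have "X \<longlonglongrightarrow> f"
  proof (rule metric_LIMSEQ_I)
    fix r :: real assume r: "0 < r"
    obtain M where M: "\<And>k N. k \<ge> M \<Longrightarrow> (\<Sum>n<N. (cmod (hardy_coeff (X k) n - a n))\<^sup>2) \<le> (r/2)\<^sup>2"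
      using bound[of "r/2"] r by auto
    show "\<exists>M. \<forall>k\<ge>M. dist (X k) f < r"
    proof (intro exI allI impI)
      fix k assume "M \<le> k"
      have "(\<Sum>n. (cmod (hardy_coeff (X k - f) n))\<^sup>2) \<le> (r/2)\<^sup>2"
        using M[OF \<open>M \<le> k\<close>] by (intro suminf_le_const summable_hardy_coeff) (simp add: f)
      then have "norm (X k - f) \<le> r/2"
        unfolding norm_hardy_eq using r by (intro real_le_lsqrt) auto
      then show "dist (X k) f < r"
        using r by (simp add: dist_norm)
    qed
  qed
  then show "convergent X"
    by (auto simp: convergent_def)
qed

text \<open>A linear functional on a subspace is given here by its graph. The representing
  vector minimizes \<open>(norm v)\<^sup>2 - 2 * l\<close> over the graph.\<close>

lemma riesz_representation_graph:
  fixes M :: "('a :: {real_inner, complete_space} \<times> real) set"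
  assumes M: "subspace M" and r: "0 \<le> r"
    and bound: "\<And>v l. (v, l) \<in> M \<Longrightarrow> \<bar>l\<bar> \<le> r * norm v"
  obtains w where "w \<in> closure (fst ` M)" "norm w \<le> r" "\<And>v l. (v, l) \<in> M \<Longrightarrow> inner w v = l"
proof -
  define J where "J p = (norm (fst p))\<^sup>2 - 2 * snd p" for p :: "'a \<times> real"
  define m where "m = Inf (J ` M)"
  \<comment> \<open>With \<open>s = norm (fst p)\<close>, \<open>J p\<close> is at least
    \<open>s\<^sup>2 - 2 * r * s\<close>; complete the square.\<close>
  have lower: "- r\<^sup>2 \<le> J p" if "p \<in> M" for p
  proof -
    have "\<bar>snd p\<bar> \<le> r * norm (fst p)"
      using bound[of "fst p" "snd p"] that by simp
    then show ?thesis
      using zero_le_power2[of "norm (fst p) - r"] unfolding J_def power2_diff by (simp add: mult.commute)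
  qed
  have bdd: "bdd_below (J ` M)"
    using lower by (rule bdd_belowI2)
  have ne: "J ` M \<noteq> {}"
    using subspace_0[OF M] by blast
  have m: "m \<le> J p" if "p \<in> M" for p
    unfolding m_def using bdd that by (intro cInf_lower) auto
  have "\<exists>p\<in>M. J p < m + 1 / real (Suc n)" for n
    using cInf_lessD[OF ne, of "m + 1 / real (Suc n)"] unfolding m_def by auto
  then obtain p where pM: "\<And>n. p n \<in> M" and pJ: "\<And>n. J (p n) < m + 1 / real (Suc n)"
    by metis
  define v where "v n = fst (p n)" for n
  \<comment> \<open>Parallelogram law: the midpoint lies in \<open>M\<close>, so its value of
    \<open>J\<close> is at least \<open>m\<close>, and two near minimizers must be close.\<close>
  have par: "(norm (fst p - fst q))\<^sup>2 \<le> 2 * (J p + J q - 2 * m)" if "p \<in> M" "q \<in> M" for p q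
  proof -
    have "(1/2) *\<^sub>R (p + q) \<in> M"
      using that M by (intro subspace_scale subspace_add)
    note m[OF this]
    moreover have "J ((1/2) *\<^sub>R (p + q)) = (J p + J q) / 2 - (norm (fst p - fst q))\<^sup>2 / 4"
      unfolding J_def by (simp add: power2_norm_eq_inner inner_simps inner_commute field_simps)
    moreover have "d \<le> 2 * (a + b - 2 * m)" if "m \<le> x" "x = (a + b) / 2 - d / 4" for a b d x :: real
      using that by (simp add: field_simps)
    ultimately show ?thesis by blast
  qed
  have "Cauchy v"
  proof (rule CauchyI)
    fix e :: real assume e: "0 < e"
    \<comment> \<open>Both values of \<open>J\<close> will exceed \<open>m\<close> by less than
      \<open>e\<^sup>2 / 4\<close>, so \<open>par\<close> bounds the squared distance by
      \<open>e\<^sup>2\<close>.\<close>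
    then obtain N where N: "1 / real (Suc N) < e\<^sup>2 / 4"
      using nat_approx_posE[of "e\<^sup>2/4"] by auto
    show "\<exists>N. \<forall>k\<ge>N. \<forall>l\<ge>N. norm (v k - v l) < e"
    proof (intro exI allI impI)
      fix k l assume kl: "N \<le> k" "N \<le> l"
      have J: "J (p k) < m + e\<^sup>2/4" if "N \<le> k" for k
      proof -
        have "1 / real (Suc k) \<le> 1 / real (Suc N)"
          using that by (intro divide_left_mono) auto
        then show ?thesis using pJ[of k] N by linarith
      qed
      have "(norm (v k - v l))\<^sup>2 < e\<^sup>2"
        using par[OF pM[of k] pM[of l]] J[OF kl(1)] J[OF kl(2)] unfolding v_def by argo
      then show "norm (v k - v l) < e"
        using e by (simp add: power_less_imp_less_base)
    qed
  qed
  then obtain w where w: "v \<longlonglongrightarrow> w"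
    using Cauchy_convergent convergent_def by blast
  have inner_w: "inner w x = l" if xl: "(x, l) \<in> M" for x l
  proof -
    \<comment> \<open>First variation of \<open>J\<close> in the direction \<open>(x, l)\<close>.
      The infimum need not be attained on \<open>M\<close>, so the inequality is proved at
      \<open>p n\<close> with the error \<open>1 / real (Suc n)\<close> and passed to the
      limit.\<close>
    have quad: "0 \<le> 2 * t * (inner w x - l) + t\<^sup>2 * (norm x)\<^sup>2" for t
    proof (rule LIMSEQ_le_const)
      have "(\<lambda>n. 2 * t * (inner (v n) x - l) + t\<^sup>2 * (norm x)\<^sup>2)
          \<longlonglongrightarrow> 2 * t * (inner w x - l) + t\<^sup>2 * (norm x)\<^sup>2"
        by (intro tendsto_intros w)
      from tendsto_add[OF this LIMSEQ_inverse_real_of_nat]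
      show "(\<lambda>n. 2 * t * (inner (v n) x - l) + t\<^sup>2 * (norm x)\<^sup>2 + 1 / real (Suc n))
          \<longlonglongrightarrow> 2 * t * (inner w x - l) + t\<^sup>2 * (norm x)\<^sup>2"
        by (simp only: inverse_eq_divide add_0_right)
      show "\<exists>N. \<forall>n\<ge>N. 0 \<le> 2 * t * (inner (v n) x - l) + t\<^sup>2 * (norm x)\<^sup>2 + 1 / real (Suc n)"
      proof (intro exI allI impI)
        fix n
        have "p n + t *\<^sub>R (x, l) \<in> M"
          using M pM xl by (intro subspace_add subspace_scale)
        from m[OF this] have "m \<le> J (p n) + 2 * t * (inner (v n) x - l) + t\<^sup>2 * (norm x)\<^sup>2"
          unfolding J_def v_def power2_norm_eq_inner
          by (simp add: inner_simps inner_commute power2_eq_square algebra_simps)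
        then show "0 \<le> 2 * t * (inner (v n) x - l) + t\<^sup>2 * (norm x)\<^sup>2 + 1 / real (Suc n)"
          using pJ[of n] by argo
      qed
    qed
    show ?thesis
    proof (cases "x = 0")
      case True
      then show ?thesis using bound[OF xl] by simp
    next
      case False
      define d where "d = inner w x - l"
      \<comment> \<open>This value of \<open>t\<close> minimizes the quadratic, whose minimum is
        negative unless \<open>d = 0\<close>.\<close>
      have "0 \<le> 2 * (- d / (norm x)\<^sup>2) * d + (- d / (norm x)\<^sup>2)\<^sup>2 * (norm x)\<^sup>2"
        using quad[of "- d / (norm x)\<^sup>2"] by (simp add: d_def)
      also have "\<dots> = - (d\<^sup>2 / (norm x)\<^sup>2)"
        using False by (simp add: power2_eq_square field_simps)
      finally have "d\<^sup>2 / (norm x)\<^sup>2 \<le> 0" by simp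
      then show ?thesis using False by (simp add: divide_le_0_iff d_def)
    qed
  qed
  show thesis
  proof
    show "w \<in> closure (fst ` M)"
      unfolding closure_sequential using pM w by (auto simp: v_def intro!: exI[of _ v])
    show "norm w \<le> r"
    proof -
      have "inner w w \<le> r * norm w"
      proof (rule LIMSEQ_le)
        show "(\<lambda>n. inner w (v n)) \<longlonglongrightarrow> inner w w" "(\<lambda>n. r * norm (v n)) \<longlonglongrightarrow> r * norm w"
          by (intro tendsto_intros w)+
        have "inner w (v n) \<le> r * norm (v n)" for n
          using bound[of "v n" "snd (p n)"] inner_w[of "v n" "snd (p n)"] pM[of n] by (simp add: v_def)
        then show "\<exists>N. \<forall>n\<ge>N. inner w (v n) \<le> r * norm (v n)" by blast
      qed
      then have "norm w * norm w \<le> r * norm w"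
        by (simp add: power2_norm_eq_inner flip: power2_eq_square)
      then show ?thesis
        using r by (cases "w = 0") auto
    qed
  qed (fact inner_w)
qed

text \<open>Baire category: the closed sets of points where all \<open>L i\<close> are bounded by
  \<open>n\<close> cover the space, so one of them contains a ball, and differences of points of
  that ball control every \<open>L i\<close> near 0.\<close>

lemma uniform_boundedness:
  fixes L :: "'i \<Rightarrow> 'a :: {real_normed_vector, complete_space} \<Rightarrow> 'b :: real_normed_vector"
  assumes L: "\<And>i. i \<in> I \<Longrightarrow> bounded_linear (L i)"
    and pointwise: "\<And>x. \<exists>C. \<forall>i\<in>I. norm (L i x) \<le> C"
  obtains C where "\<And>i x. i \<in> I \<Longrightarrow> norm (L i x) \<le> C * norm x"
proof -
  define S where "S n = {x. \<forall>i\<in>I. norm (L i x) \<le> real n}" for n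
  have closed: "closed (S n)" for n
  proof -
    have "S n = (\<Inter>i\<in>I. {x. norm (L i x) \<le> real n})" by (auto simp: S_def)
    moreover have "closed {x. norm (L i x) \<le> real n}" if "i \<in> I" for i
      using linear_continuous_on[OF L[OF that], of UNIV]
      by (intro closed_Collect_le continuous_on_norm continuous_on_const)
    ultimately show ?thesis by auto
  qed
  have cover: "(\<Union>n. S n) = UNIV"
  proof -
    have "\<exists>n. x \<in> S n" for x
    proof -
      obtain C where "\<forall>i\<in>I. norm (L i x) \<le> C" using pointwise by blast
      moreover obtain n where "C \<le> real n" using real_arch_simple by blast
      ultimately show ?thesis unfolding S_def by (blast intro: order_trans)
    qed
    then show ?thesis by blast
  qed
  have "\<exists>n. interior (S n) \<noteq> {}"
  proof (rule ccontr)
    assume "\<not> ?thesis"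
    then have "Met_TC.mtopology interior_of \<Union> (range S) = {}"
      using closed by (intro Met_TC.metric_Baire_category_alt)
        (auto simp: complete_UNIV mcomplete_iff_complete)
    then show False using cover by simp
  qed
  then obtain n x where "x \<in> interior (S n)" by blast
  then obtain e where e: "e > 0" "cball x e \<subseteq> S n"
    by (meson interior_subset mem_interior_cball)
  show thesis
  proof
    fix i y assume i: "i \<in> I"
    interpret bounded_linear "L i" by (rule L[OF i])
    show "norm (L i y) \<le> (2 * real n / e) * norm y"
    proof (cases "y = 0")
      case True
      then show ?thesis by (simp add: zero)
    next
      case False
      define z where "z = (e / norm y) *\<^sub>R y"
      have "x + z \<in> S n" "x \<in> S n"
        using e False by (auto simp: z_def dist_norm subset_iff)
      then have "norm (L i (x + z)) \<le> real n" "norm (L i x) \<le> real n"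
        using i by (auto simp: S_def)
      then have "norm (L i z) \<le> 2 * real n"
        using norm_triangle_ineq4[of "L i (x + z)" "L i x"] by (simp add: add)
      moreover have "norm (L i z) = e / norm y * norm (L i y)"
        using e by (simp add: z_def scaleR)
      ultimately show ?thesis
        using e False by (simp add: field_simps)
    qed
  qed
qed

section \<open>Restrictions of Hardy space functions\<close>

lemma of_real_norm_hardy: "complex_of_real ((norm f)\<^sup>2) = hardy_cinner f f"
  by (simp add: norm_hardy_eq hardy_cinner_self suminf_nonneg summable_hardy_coeff)

lemma hardy_cinner_add_right: "hardy_cinner h (f + g) = hardy_cinner h f + hardy_cinner h g"
  by (metis hardy_cinner_add hardy_cinner_cnj complex_cnj_add)

lemma hardy_cinner_scale_right: "hardy_cinner h (hardy_scale c f) = cnj c * hardy_cinner h f"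
  by (metis hardy_cinner_scale hardy_cinner_cnj complex_cnj_mult)

lemma hardy_cinner_0_right [simp]: "hardy_cinner f 0 = 0"
  by (simp add: hardy_cinner_def)

lemma hardy_cinner_sum_right: "hardy_cinner h (\<Sum>a\<in>F. g a) = (\<Sum>a\<in>F. hardy_cinner h (g a))"
  by (induction F rule: infinite_finite_induct) (auto simp: hardy_cinner_add_right)

lemma norm_hardy_scale: "norm (hardy_scale c f) = cmod c * norm f"
proof -
  have "complex_of_real ((norm (hardy_scale c f))\<^sup>2) = complex_of_real ((cmod c * norm f)\<^sup>2)"
    unfolding of_real_norm_hardy hardy_cinner_scale hardy_cinner_scale_right power_mult_distrib
      of_real_mult complex_norm_square
    by (simp add: mult_ac)
  then show ?thesis
    unfolding of_real_eq_iff by (simp add: power2_eq_iff_nonneg)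
qed

text \<open>The real Cauchy-Schwarz inequality sees only real parts. The phase \<open>u\<close>
  rotates the complex inner product onto the positive real axis; it is 0 if the inner product is
  0.\<close>

lemma norm_hardy_cinner_le: "cmod (hardy_cinner f g) \<le> norm f * norm g"
proof -
  define u where "u = cnj (sgn (hardy_cinner f g))"
  have u: "cmod u \<le> 1" by (simp add: u_def norm_sgn)
  have "u * hardy_cinner f g = complex_of_real (cmod (hardy_cinner f g))"
    by (cases "hardy_cinner f g = 0")
      (simp_all add: u_def sgn_eq complex_norm_square[symmetric] power2_eq_square mult.commute[of "cnj _"])
  then have "cmod (hardy_cinner f g) = inner (hardy_scale u f) g"
    by (simp add: inner_hardy_def hardy_cinner_scale)
  also have "\<dots> \<le> norm (hardy_scale u f) * norm g"
    by (rule norm_cauchy_schwarz)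
  also have "\<dots> \<le> norm f * norm g"
    using u by (auto simp: norm_hardy_scale intro!: mult_right_mono mult_left_le_one_le)
  finally show ?thesis .
qed

lemma bounded_linear_hardy_cinner: "bounded_linear (\<lambda>f. hardy_cinner f g)"
  by (rule bounded_linear_intro[where K = "norm g"])
    (auto simp: hardy_cinner_add scaleR_hardy_def hardy_cinner_scale norm_hardy_cinner_le
      scaleR_conv_of_real)

lemma hardy_eval_add:
  "x \<in> unit_disk \<Longrightarrow> hardy_eval (f + g) x = hardy_eval f x + hardy_eval g x"
  by (simp add: hardy_cinner_add flip: hardy_reproducing)

lemma hardy_eval_scale:
  "x \<in> unit_disk \<Longrightarrow> hardy_eval (hardy_scale c f) x = c * hardy_eval f x"
  by (simp add: hardy_cinner_scale flip: hardy_reproducing)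

lemma hardy_eval_diff:
  "x \<in> unit_disk \<Longrightarrow> hardy_eval (f - g) x = hardy_eval f x - hardy_eval g x"
  using hardy_eval_add[of x "f - g" g] by simp

section \<open>Kernel sums and the dual description of restrictions\<close>

definition kernel_sum :: "complex set \<Rightarrow> (complex \<Rightarrow> complex) \<Rightarrow> hardy"
  where "kernel_sum F c = (\<Sum>a\<in>F. hardy_scale (c a) (hardy_kernel a))"

lemma hardy_cinner_kernel_sum:
  assumes "F \<subseteq> unit_disk"
  shows "hardy_cinner f (kernel_sum F c) = (\<Sum>a\<in>F. cnj (c a) * hardy_eval f a)"
  unfolding kernel_sum_def hardy_cinner_sum_right hardy_cinner_scale_right
  using assms by (intro sum.cong refl) (auto simp: hardy_reproducing)

lemma kernel_sum_extend:
  assumes "finite G" "F \<subseteq> G"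
  shows "kernel_sum F c = kernel_sum G (\<lambda>a. if a \<in> F then c a else 0)"
  unfolding kernel_sum_def
  using assms by (intro sum.mono_neutral_cong_left) auto

lemma kernel_sum_add: "kernel_sum F c + kernel_sum F d = kernel_sum F (\<lambda>a. c a + d a)"
  by (simp add: kernel_sum_def hardy.scale_left_distrib sum.distrib)

lemma kernel_sum_scale: "hardy_scale r (kernel_sum F c) = kernel_sum F (\<lambda>a. r * c a)"
  by (simp add: kernel_sum_def hardy.scale_sum_right)

lemma kernel_sum_in_span: "F \<subseteq> A \<Longrightarrow> kernel_sum F c \<in> hardy.span (hardy_kernel ` A)"
  unfolding kernel_sum_def by (intro hardy.span_sum hardy.span_scale hardy.span_base) auto

text \<open>By duality, this says that \<open>h\<close> is the restriction to \<open>A\<close> of a Hardy space function of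
  norm at most \<open>r\<close>.\<close>

definition kernel_bound :: "complex set \<Rightarrow> (complex \<Rightarrow> complex) \<Rightarrow> real \<Rightarrow> bool"
  where "kernel_bound A h r \<longleftrightarrow> (\<forall>F c. finite F \<longrightarrow> F \<subseteq> A \<longrightarrow>
    cmod (\<Sum>a\<in>F. cnj (c a) * h a) \<le> r * norm (kernel_sum F c))"

lemma kernel_boundI:
  assumes "\<And>F c. finite F \<Longrightarrow> F \<subseteq> A \<Longrightarrow>
    cmod (\<Sum>a\<in>F. cnj (c a) * h a) \<le> r * norm (kernel_sum F c)"
  shows "kernel_bound A h r"
  using assms by (simp add: kernel_bound_def)

lemma kernel_boundD:
  assumes "kernel_bound A h r" "finite F" "F \<subseteq> A"
  shows "cmod (\<Sum>a\<in>F. cnj (c a) * h a) \<le> r * norm (kernel_sum F c)"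
  using assms by (simp add: kernel_bound_def)

lemma kernel_bound_cong:
  assumes "\<And>a. a \<in> A \<Longrightarrow> g a = h a"
  shows "kernel_bound A g r \<longleftrightarrow> kernel_bound A h r"
proof -
  have "(\<Sum>a\<in>F. cnj (c a) * g a) = (\<Sum>a\<in>F. cnj (c a) * h a)" if "F \<subseteq> A" for F c
    using assms that by (intro sum.cong) auto
  then show ?thesis by (simp add: kernel_bound_def)
qed

lemma kernel_bound_mono:
  assumes "kernel_bound A h r" "r \<le> s"
  shows "kernel_bound A h s"
proof (rule kernel_boundI)
  fix F c assume "finite F" "F \<subseteq> A"
  then show "cmod (\<Sum>a\<in>F. cnj (c a) * h a) \<le> s * norm (kernel_sum F c)"
    using kernel_boundD[OF assms(1), of F c] mult_right_mono[OF assms(2), of "norm (kernel_sum F c)"]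
    by simp
qed

lemma kernel_bound_scale:
  assumes "kernel_bound A h r"
  shows "kernel_bound A (\<lambda>a. z * h a) (cmod z * r)"
proof (rule kernel_boundI)
  fix F c assume F: "finite F" "F \<subseteq> A"
  have "cmod (\<Sum>a\<in>F. cnj (c a) * (z * h a)) = cmod z * cmod (\<Sum>a\<in>F. cnj (c a) * h a)"
    by (simp add: norm_mult sum_distrib_left mult.left_commute flip: norm_mult)
  also have "\<dots> \<le> cmod z * (r * norm (kernel_sum F c))"
    by (intro mult_left_mono kernel_boundD[OF assms F]) simp
  finally show "cmod (\<Sum>a\<in>F. cnj (c a) * (z * h a)) \<le> cmod z * r * norm (kernel_sum F c)"
    by (simp add: mult.assoc)
qed

lemma kernel_bound_eval:
  assumes "A \<subseteq> unit_disk"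
  shows "kernel_bound A (hardy_eval f) (norm f)"
proof (rule kernel_boundI)
  fix F c assume "F \<subseteq> A"
  then show "cmod (\<Sum>a\<in>F. cnj (c a) * hardy_eval f a) \<le> norm f * norm (kernel_sum F c)"
    using norm_hardy_cinner_le[of f "kernel_sum F c"] assms by (simp add: hardy_cinner_kernel_sum)
qed

text \<open>The bound forces the functional to vanish on null combinations, so it is well defined on
  the span of the kernel functions. Riesz representation yields \<open>w\<close>, and testing on a
  single kernel function gives its values.\<close>

lemma kernel_bound_imp_eval:
  assumes A: "A \<subseteq> unit_disk" and r: "0 \<le> r" and h: "kernel_bound A h r"
  obtains w where "w \<in> hardy_sub A" "norm w \<le> r" "\<And>a. a \<in> A \<Longrightarrow> hardy_eval w a = h a"
proof -
  define S where "S F c = (\<Sum>a\<in>F. cnj (c a) * h a)" for F c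
  \<comment> \<open>The graph of the functional, with real parts because Riesz representation is
    used for the real inner product.\<close>
  define M where "M = {(kernel_sum F c, Re (S F c)) | F c. finite F \<and> F \<subseteq> A}"
  have S_extend: "S F c = S G (\<lambda>a. if a \<in> F then c a else 0)" if "finite G" "F \<subseteq> G" for F G c
    unfolding S_def using that by (intro sum.mono_neutral_cong_left) auto
  have "subspace M"
    unfolding subspace_def
  proof (intro conjI ballI allI)
    have "(kernel_sum {} (\<lambda>_. 0), Re (S {} (\<lambda>_. 0))) \<in> M"
      unfolding M_def by blast
    then show "0 \<in> M" by (simp add: S_def kernel_sum_def zero_prod_def)
  next
    fix p q assume "p \<in> M" "q \<in> M"
    then obtain F c G d where
      p: "p = (kernel_sum F c, Re (S F c))" "finite F" "F \<subseteq> A" and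
      q: "q = (kernel_sum G d, Re (S G d))" "finite G" "G \<subseteq> A"
      by (auto simp: M_def)
    define c' where "c' a = (if a \<in> F then c a else 0)" for a
    define d' where "d' a = (if a \<in> G then d a else 0)" for a
    have fin: "finite (F \<union> G)" using p q by simp
    have "kernel_sum F c = kernel_sum (F \<union> G) c'" "S F c = S (F \<union> G) c'"
      unfolding c'_def by (intro kernel_sum_extend S_extend fin; simp)+
    moreover have "kernel_sum G d = kernel_sum (F \<union> G) d'" "S G d = S (F \<union> G) d'"
      unfolding d'_def by (intro kernel_sum_extend S_extend fin; simp)+
    ultimately have "p = (kernel_sum (F \<union> G) c', Re (S (F \<union> G) c'))"
      "q = (kernel_sum (F \<union> G) d', Re (S (F \<union> G) d'))"
      using p(1) q(1) by auto
    then have "p + q = (kernel_sum (F \<union> G) (\<lambda>a. c' a + d' a), Re (S (F \<union> G) (\<lambda>a. c' a + d' a)))"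
      by (simp add: kernel_sum_add S_def distrib_right sum.distrib)
    then show "p + q \<in> M" using p q unfolding M_def by blast
  next
    fix t :: real and p assume "p \<in> M"
    then obtain F c where p: "p = (kernel_sum F c, Re (S F c))" "finite F" "F \<subseteq> A"
      by (auto simp: M_def)
    have "t *\<^sub>R p = (kernel_sum F (\<lambda>a. of_real t * c a), Re (S F (\<lambda>a. of_real t * c a)))"
      by (simp add: p scaleR_hardy_def kernel_sum_scale S_def mult.assoc flip: sum_distrib_left)
    then show "t *\<^sub>R p \<in> M" using p unfolding M_def by blast
  qed
  moreover have "\<bar>l\<bar> \<le> r * norm v" if "(v, l) \<in> M" for v l
  proof -
    from that obtain F c where p: "v = kernel_sum F c" "l = Re (S F c)" "finite F" "F \<subseteq> A"
      by (auto simp: M_def)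
    then show ?thesis
      using kernel_boundD[OF h, of F c] abs_Re_le_cmod[of "S F c"] by (simp add: S_def)
  qed
  ultimately obtain w where w: "w \<in> closure (fst ` M)" "norm w \<le> r"
    and inner_w: "\<And>v l. (v, l) \<in> M \<Longrightarrow> inner w v = l"
    using riesz_representation_graph[OF _ r] by metis
  show thesis
  proof
    have "fst ` M \<subseteq> hardy.span (hardy_kernel ` A)"
      using kernel_sum_in_span by (auto simp: M_def)
    then show "w \<in> hardy_sub A"
      using w closure_mono unfolding hardy_sub_def by blast
    show "norm w \<le> r" by fact
  next
    fix a assume a: "a \<in> A"
    \<comment> \<open>A single kernel function with coefficient \<open>z\<close>; the choices 1 and
      \<open>\<i>\<close> recover the real and the imaginary part.\<close>
    have eq: "Re (cnj z * hardy_eval w a) = Re (cnj z * h a)" for z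
    proof -
      have "(kernel_sum {a} (\<lambda>_. z), Re (S {a} (\<lambda>_. z))) \<in> M"
        using a unfolding M_def by blast
      from inner_w[OF this] show ?thesis
        using hardy_cinner_kernel_sum[of "{a}" w] a A by (auto simp: S_def inner_hardy_def)
    qed
    show "hardy_eval w a = h a"
      using eq[of 1] eq[of \<i>] by (simp add: complex_eq_iff)
  qed
qed

lemma hardy_on_obtain:
  assumes A: "A \<subseteq> unit_disk" and h: "h \<in> hardy_on A"
  obtains w where "w \<in> hardy_sub A" "h = hardy_restrict A w" "hardy_on_norm A h = norm w"
proof -
  from h obtain w where w: "w \<in> hardy_sub A" "h = hardy_restrict A w"
    by (auto simp: hardy_on_def)
  moreover have "hardy_on_norm A h = norm w"
    unfolding hardy_on_norm_def w(2)
    by (simp add: the_inv_into_f_f[OF inj_on_hardy_restrict[OF A] w(1)])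
  ultimately show thesis by (rule that)
qed

text \<open>Replaces the norm of \<open>hardy_on\<close>, which goes through an inverse of
  restriction, by inequalities over finite sets. From right to left the extension comes from Riesz
  representation.\<close>

lemma hardy_on_kernel_bound_iff:
  assumes A: "A \<subseteq> unit_disk" and r: "0 \<le> r"
  shows "h \<in> hardy_on A \<and> hardy_on_norm A h \<le> r \<longleftrightarrow> h \<in> extensional A \<and> kernel_bound A h r"
proof (intro iffI conjI)
  assume h: "h \<in> hardy_on A \<and> hardy_on_norm A h \<le> r"
  then obtain w where w: "w \<in> hardy_sub A" "h = hardy_restrict A w" "hardy_on_norm A h = norm w"
    using hardy_on_obtain[OF A] by blast
  show "h \<in> extensional A" by (simp add: w(2) hardy_restrict_def)
  have "kernel_bound A h (norm w)"
    using kernel_bound_eval[OF A, of w] by (subst kernel_bound_cong) (auto simp: w(2) hardy_restrict_def)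
  then show "kernel_bound A h r"
    by (rule kernel_bound_mono) (use h w in simp)
next
  assume h: "h \<in> extensional A \<and> kernel_bound A h r"
  then obtain w where w: "w \<in> hardy_sub A" "norm w \<le> r" "\<And>a. a \<in> A \<Longrightarrow> hardy_eval w a = h a"
    using kernel_bound_imp_eval[OF A r] by blast
  have hw: "h = hardy_restrict A w"
    using h w(3) by (intro extensionalityI[of _ A]) (auto simp: hardy_restrict_def)
  then show "h \<in> hardy_on A" using w by (auto simp: hardy_on_def)
  show "hardy_on_norm A h \<le> r"
    unfolding hardy_on_norm_def hw using w(2)
    by (simp add: the_inv_into_f_f[OF inj_on_hardy_restrict[OF A] w(1)])
qed

lemma hardy_on_norm_nonneg:
  assumes "A \<subseteq> unit_disk" "h \<in> hardy_on A"
  shows "0 \<le> hardy_on_norm A h"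
  using hardy_on_obtain[OF assms] by (metis norm_ge_zero)

lemma kernel_bound_hardy_on_norm:
  assumes "A \<subseteq> unit_disk" "h \<in> hardy_on A"
  shows "kernel_bound A h (hardy_on_norm A h)"
  using hardy_on_kernel_bound_iff[OF assms(1) hardy_on_norm_nonneg[OF assms]] assms(2) by blast

lemma hardy_onI:
  assumes "A \<subseteq> unit_disk" "h \<in> extensional A" "kernel_bound A h r"
  shows "h \<in> hardy_on A"
  using hardy_on_kernel_bound_iff[OF assms(1), of "max 0 r" h] assms kernel_bound_mono[of A h r "max 0 r"]
  by simp

lemma hardy_on_extensional: "h \<in> hardy_on A \<Longrightarrow> h \<in> extensional A"
  by (auto simp: hardy_on_def hardy_restrict_def)

lemma hardy_restrict_in_hardy_on:
  assumes "A \<subseteq> unit_disk"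
  shows "hardy_restrict A f \<in> hardy_on A" "hardy_on_norm A (hardy_restrict A f) \<le> norm f"
proof -
  have "kernel_bound A (hardy_restrict A f) (norm f)"
    using kernel_bound_eval[OF assms, of f]
    by (subst kernel_bound_cong) (auto simp: hardy_restrict_def)
  then show "hardy_restrict A f \<in> hardy_on A" "hardy_on_norm A (hardy_restrict A f) \<le> norm f"
    using hardy_on_kernel_bound_iff[OF assms, of "norm f" "hardy_restrict A f"]
    by (auto simp: hardy_restrict_def)
qed

lemma hardy_on_scale:
  assumes "A \<subseteq> unit_disk" "h \<in> hardy_on A"
  shows "(\<lambda>x\<in>A. c * h x) \<in> hardy_on A"
proof (rule hardy_onI[OF assms(1)])
  show "kernel_bound A (\<lambda>x\<in>A. c * h x) (cmod c * hardy_on_norm A h)"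
    using kernel_bound_scale[OF kernel_bound_hardy_on_norm[OF assms]]
    by (subst kernel_bound_cong) auto
qed simp

section \<open>Multipliers, their operator norm and Pick positivity\<close>

lemma multipliers_extensional: "f \<in> multipliers A \<Longrightarrow> f \<in> extensional A"
  by (simp add: multipliers_def)

lemma multipliersD: "f \<in> multipliers A \<Longrightarrow> h \<in> hardy_on A \<Longrightarrow> (\<lambda>x\<in>A. f x * h x) \<in> hardy_on A"
  by (simp add: multipliers_def)

text \<open>Needed before the real supremum can serve as an operator norm. Uniform boundedness is
  applied to the functionals that pair \<open>f * h\<close> with normalized kernel sums; they are
  pointwise bounded because \<open>f * h\<close> lies in \<open>hardy_on A\<close>.\<close>

lemma multiplier_bounded:
  assumes A: "A \<subseteq> unit_disk" and f: "f \<in> multipliers A"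
  shows "bdd_above {hardy_on_norm A (\<lambda>x\<in>A. f x * h x) | h. h \<in> hardy_on A \<and> hardy_on_norm A h \<le> 1}"
proof -
  define I where "I = {(F, c :: complex \<Rightarrow> complex). finite F \<and> F \<subseteq> A}"
  \<comment> \<open>The adjoint of multiplication by \<open>f\<close> multiplies the coefficient at
    \<open>a\<close> by \<open>cnj (f a)\<close>. For a vanishing kernel sum
    \<open>inverse 0 = 0\<close> makes the functional 0.\<close>
  define L where "L = (\<lambda>(F, c) h. inverse (norm (kernel_sum F c))
      *\<^sub>R hardy_cinner h (kernel_sum F (\<lambda>a. c a * cnj (f a))))"
  have L: "L (F, c) h = inverse (norm (kernel_sum F c)) *\<^sub>R (\<Sum>a\<in>F. cnj (c a) * (f a * hardy_eval h a))"
    if "F \<subseteq> A" for F c h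
    unfolding L_def using that A by (simp add: hardy_cinner_kernel_sum mult.assoc)
  have pt: "\<exists>C. kernel_bound A (\<lambda>a. f a * hardy_eval h a) C" for h
  proof -
    have "(\<lambda>x\<in>A. f x * hardy_restrict A h x) \<in> hardy_on A"
      using f hardy_restrict_in_hardy_on(1)[OF A] by (rule multipliersD)
    note kernel_bound_hardy_on_norm[OF A this]
    also have "kernel_bound A (\<lambda>x\<in>A. f x * hardy_restrict A h x) r
        \<longleftrightarrow> kernel_bound A (\<lambda>a. f a * hardy_eval h a) r" for r
      by (rule kernel_bound_cong) (simp add: hardy_restrict_def)
    finally show ?thesis by blast
  qed
  obtain C where C: "\<And>i h. i \<in> I \<Longrightarrow> norm (L i h) \<le> C * norm h"
  proof (rule uniform_boundedness[of I L])
    fix i assume "i \<in> I"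
    then show "bounded_linear (L i)"
      unfolding L_def
      by (auto split: prod.split intro!: bounded_linear_const_scaleR bounded_linear_hardy_cinner)
  next
    fix h
    obtain C where C: "kernel_bound A (\<lambda>a. f a * hardy_eval h a) C" using pt by blast
    have "norm (L (F, c) h) \<le> \<bar>C\<bar>" if "finite F" "F \<subseteq> A" for F c
    proof (cases "norm (kernel_sum F c) = 0")
      case True
      then show ?thesis by (simp add: L_def)
    next
      case False
      then have "norm (L (F, c) h) \<le> C"
        using kernel_boundD[OF C that, of c] that(2)
        by (simp add: L divide_simps norm_scaleR mult.commute)
      then show ?thesis by simp
    qed
    then show "\<exists>C. \<forall>i\<in>I. norm (L i h) \<le> C"
      by (auto simp: I_def)
  qed blast
  have "hardy_on_norm A (\<lambda>x\<in>A. f x * h x) \<le> \<bar>C\<bar>" if h: "h \<in> hardy_on A" "hardy_on_norm A h \<le> 1" for h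
  proof -
    obtain w where w: "h = hardy_restrict A w" "norm w \<le> 1"
      using hardy_on_obtain[OF A h(1)] h(2) by metis
    \<comment> \<open>For a vanishing kernel sum \<open>L\<close> carries no information; there the
      bound \<open>C'\<close> for this particular \<open>w\<close> is used.\<close>
    obtain C' where C': "kernel_bound A (\<lambda>a. f a * hardy_eval w a) C'" using pt by blast
    have "kernel_bound A (\<lambda>a. f a * hardy_eval w a) \<bar>C\<bar>"
    proof (rule kernel_boundI)
      fix F c assume F: "finite F" "F \<subseteq> A"
      show "cmod (\<Sum>a\<in>F. cnj (c a) * (f a * hardy_eval w a)) \<le> \<bar>C\<bar> * norm (kernel_sum F c)"
      proof (cases "norm (kernel_sum F c) = 0")
        case True
        then show ?thesis using kernel_boundD[OF C' F, of c] by simp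
      next
        case False
        have "norm (L (F, c) w) \<le> C * norm w" using F by (intro C) (simp add: I_def)
        also have "\<dots> \<le> \<bar>C\<bar> * 1" using w(2) by (intro mult_mono) auto
        finally show ?thesis using False F
          by (simp add: L divide_simps norm_scaleR mult.commute)
      qed
    qed
    then have "kernel_bound A (\<lambda>x\<in>A. f x * h x) \<bar>C\<bar>"
      by (subst kernel_bound_cong) (auto simp: w hardy_restrict_def)
    then show ?thesis
      using hardy_on_kernel_bound_iff[OF A, of "\<bar>C\<bar>" "\<lambda>x\<in>A. f x * h x"] by simp
  qed
  then show ?thesis by (auto simp: bdd_above_def)
qed

lemma contractive_multiplier_kernel_bound:
  assumes A: "A \<subseteq> unit_disk" and f: "f \<in> multipliers A" and le: "multiplier_norm A f \<le> 1"
  shows "kernel_bound A (\<lambda>a. f a * hardy_eval w a) (norm w)"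
proof (cases "w = 0")
  case True
  then show ?thesis by (simp add: kernel_bound_def hardy_eval_def)
next
  case False
  \<comment> \<open>The operator norm tests the unit ball only, so \<open>w\<close> is normalized
    and the factor \<open>norm w\<close> is restored afterwards.\<close>
  define v where "v = hardy_scale (inverse (of_real (norm w))) w"
  define h where "h = hardy_restrict A v"
  have v: "norm v = 1" using False by (simp add: v_def norm_hardy_scale norm_inverse)
  have h: "h \<in> hardy_on A" "hardy_on_norm A h \<le> 1"
    using hardy_restrict_in_hardy_on[OF A, of v] by (auto simp: h_def v)
  have "hardy_on_norm A (\<lambda>x\<in>A. f x * h x) \<le> multiplier_norm A f"
    unfolding multiplier_norm_def
    using h by (intro cSup_upper multiplier_bounded A f) blast
  then have "kernel_bound A (\<lambda>x\<in>A. f x * h x) 1"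
    using hardy_on_kernel_bound_iff[OF A, of 1 "\<lambda>x\<in>A. f x * h x"] le multipliersD[OF f h(1)] by simp
  from kernel_bound_scale[OF this, of "of_real (norm w)"]
  have "kernel_bound A (\<lambda>a. of_real (norm w) * (\<lambda>x\<in>A. f x * h x) a) (norm w)" by simp
  also have "kernel_bound A (\<lambda>a. of_real (norm w) * (\<lambda>x\<in>A. f x * h x) a) (norm w)
      \<longleftrightarrow> kernel_bound A (\<lambda>a. f a * hardy_eval w a) (norm w)"
    by (rule kernel_bound_cong)
      (use A False in \<open>auto simp: h_def hardy_restrict_def v_def hardy_eval_scale subset_iff\<close>)
  finally show ?thesis .
qed

text \<open>Positivity of the Pick kernel \<open>(1 - f x * cnj (f y)) / (1 - x * cnj y)\<close>.\<close>

definition pick_positive :: "complex set \<Rightarrow> (complex \<Rightarrow> complex) \<Rightarrow> bool"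
  where "pick_positive A f \<longleftrightarrow> (\<forall>F c. finite F \<longrightarrow> F \<subseteq> A \<longrightarrow>
    norm (kernel_sum F (\<lambda>a. c a * cnj (f a))) \<le> norm (kernel_sum F c))"

text \<open>The adjoint of a contraction is a contraction. Applied to \<open>kernel_sum F c\<close>
  it gives \<open>v\<close>, and \<open>hardy_cinner v v\<close> is the pairing of
  \<open>f * v\<close> with \<open>kernel_sum F c\<close>, of modulus at most
  \<open>norm v * norm (kernel_sum F c)\<close>.\<close>

lemma contractive_multiplier_pick_positive:
  assumes A: "A \<subseteq> unit_disk" and f: "f \<in> multipliers A" and le: "multiplier_norm A f \<le> 1"
  shows "pick_positive A f"
  unfolding pick_positive_def
proof (intro allI impI)
  fix F c assume F: "finite F" "F \<subseteq> A"
  define v where "v = kernel_sum F (\<lambda>a. c a * cnj (f a))"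
  have "(norm v)\<^sup>2 = cmod (hardy_cinner v v)"
    unfolding of_real_norm_hardy[symmetric] norm_of_real by simp
  also have "hardy_cinner v v = (\<Sum>a\<in>F. cnj (c a) * (f a * hardy_eval v a))"
    using F A by (subst (2) v_def) (simp add: hardy_cinner_kernel_sum mult.assoc)
  also have "cmod \<dots> \<le> norm v * norm (kernel_sum F c)"
    using F by (intro kernel_boundD[OF contractive_multiplier_kernel_bound[OF A f le]])
  finally have "norm v * norm v \<le> norm v * norm (kernel_sum F c)"
    by (simp add: power2_eq_square)
  then show "norm v \<le> norm (kernel_sum F c)"
    by (cases "v = 0") auto
qed

text \<open>In the dual description, multiplying \<open>h\<close> by \<open>f\<close> amounts to
  changing the coefficients \<open>c a\<close> to \<open>c a * cnj (f a)\<close>, and positivity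
  says that this does not increase the norm of the kernel sum.\<close>

lemma pick_positive_contractive_multiplier:
  assumes A: "A \<subseteq> unit_disk" and f: "f \<in> extensional A" and pos: "pick_positive A f"
  shows "f \<in> multipliers A" "multiplier_norm A f \<le> 1"
proof -
  have bound: "kernel_bound A (\<lambda>x\<in>A. f x * h x) r" if h: "kernel_bound A h r" and r: "0 \<le> r" for h r
  proof (rule kernel_boundI)
    fix F c assume F: "finite F" "F \<subseteq> A"
    have "(\<Sum>a\<in>F. cnj (c a) * (\<lambda>x\<in>A. f x * h x) a) = (\<Sum>a\<in>F. cnj (c a * cnj (f a)) * h a)"
      using F by (intro sum.cong) auto
    also have "cmod \<dots> \<le> r * norm (kernel_sum F (\<lambda>a. c a * cnj (f a)))"
      using h F by (rule kernel_boundD)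
    also have "\<dots> \<le> r * norm (kernel_sum F c)"
      using pos F r unfolding pick_positive_def by (intro mult_left_mono) auto
    finally show "cmod (\<Sum>a\<in>F. cnj (c a) * (\<lambda>x\<in>A. f x * h x) a) \<le> r * norm (kernel_sum F c)" .
  qed
  have *: "(\<lambda>x\<in>A. f x * h x) \<in> hardy_on A \<and>
      hardy_on_norm A (\<lambda>x\<in>A. f x * h x) \<le> hardy_on_norm A h" if "h \<in> hardy_on A" for h
    using hardy_on_kernel_bound_iff[OF A hardy_on_norm_nonneg[OF A that], of "\<lambda>x\<in>A. f x * h x"]
      bound[OF kernel_bound_hardy_on_norm[OF A that] hardy_on_norm_nonneg[OF A that]] by simp
  then show "f \<in> multipliers A" using f by (simp add: multipliers_def)
  show "multiplier_norm A f \<le> 1"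
    unfolding multiplier_norm_def
  proof (rule cSup_least)
    have "hardy_restrict A 0 \<in> hardy_on A" "hardy_on_norm A (hardy_restrict A 0) \<le> 1"
      using hardy_restrict_in_hardy_on[OF A, of 0] by auto
    then show "{hardy_on_norm A (\<lambda>x\<in>A. f x * h x) |h. h \<in> hardy_on A \<and> hardy_on_norm A h \<le> 1} \<noteq> {}"
      by blast
  qed (use * in force)
qed

section \<open>Moebius functions as multipliers\<close>

lemma one_minus_mult_cnj_nonzero:
  assumes "x \<in> unit_disk" "y \<in> unit_disk"
  shows "1 - x * cnj y \<noteq> 0"
proof
  assume "1 - x * cnj y = 0"
  then have "cmod x * cmod y = 1"
    by (metis complex_mod_cnj norm_mult norm_one right_minus_eq)
  then show False
    using assms mult_strict_mono'[of "cmod x" 1 "cmod y" 1] by simp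
qed

lemma one_minus_cnj_mult_nonzero:
  assumes "x \<in> unit_disk" "y \<in> unit_disk"
  shows "1 - cnj x * y \<noteq> 0"
  using one_minus_mult_cnj_nonzero[OF assms(2,1)] by (simp add: mult.commute)

lemma Moebius_function_in_unit_disk:
  "a \<in> unit_disk \<Longrightarrow> x \<in> unit_disk \<Longrightarrow> Moebius_function t a x \<in> unit_disk"
  using Moebius_function_norm_lt_1 by simp

lemma Moebius_function_inverse:
  assumes "a \<in> unit_disk" "x \<in> unit_disk"
  shows "Moebius_function 0 (- a) (Moebius_function 0 a x) = x"
    "Moebius_function 0 a (Moebius_function 0 (- a) x) = x"
  using assms by (auto intro: Moebius_function_compose)

lemma Moebius_function_eq_0_iff:
  assumes "a \<in> unit_disk" "x \<in> unit_disk"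
  shows "Moebius_function t a x = 0 \<longleftrightarrow> x = a"
  using one_minus_cnj_mult_nonzero[OF assms] by (simp add: Moebius_function_def)

text \<open>The source of all invariance: composing the kernel with a Moebius function changes it
  only by a constant and by factors depending on one variable each.\<close>

lemma one_minus_Moebius_function:
  assumes "a \<in> unit_disk" "x \<in> unit_disk" "y \<in> unit_disk"
  shows "1 - Moebius_function 0 a x * cnj (Moebius_function 0 a y)
    = (1 - a * cnj a) * (1 - x * cnj y) / ((1 - cnj a * x) * (1 - a * cnj y))"
proof -
  define p q where "p = 1 - cnj a * x" and "q = 1 - a * cnj y"
  have "p \<noteq> 0" "q \<noteq> 0"
    using one_minus_cnj_mult_nonzero[OF assms(1,2)] one_minus_mult_cnj_nonzero[OF assms(1,3)]
    by (simp_all add: p_def q_def)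
  then have "1 - (x - a) / p * ((cnj y - cnj a) / q) = (p * q - (x - a) * (cnj y - cnj a)) / (p * q)"
    by (simp add: divide_simps)
  also have "p * q - (x - a) * (cnj y - cnj a) = (1 - a * cnj a) * (1 - x * cnj y)"
    unfolding p_def q_def by (simp add: algebra_simps)
  finally show ?thesis
    by (simp add: Moebius_function_simple p_def q_def)
qed

lemma hardy_eval_kernel_sum:
  assumes "finite F" "F \<subseteq> unit_disk" "x \<in> unit_disk"
  shows "hardy_eval (kernel_sum F c) x = (\<Sum>y\<in>F. c y / (1 - x * cnj y))"
proof -
  have "hardy_eval (kernel_sum F c) x = cnj (hardy_cinner (hardy_kernel x) (kernel_sum F c))"
    using assms by (simp add: hardy_cinner_cnj hardy_reproducing)
  also have "\<dots> = (\<Sum>y\<in>F. cnj (cnj (c y) * (1 / (1 - y * cnj x))))"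
    unfolding hardy_cinner_kernel_sum[OF assms(2)] cnj_sum
    using assms by (intro sum.cong refl) (auto simp: hardy_eval_kernel subset_iff)
  finally show ?thesis by (simp add: mult.commute)
qed

lemma norm_kernel_sum:
  assumes "finite F" "F \<subseteq> unit_disk"
  shows "complex_of_real ((norm (kernel_sum F c))\<^sup>2)
    = (\<Sum>x\<in>F. \<Sum>y\<in>F. cnj (c x) * c y / (1 - x * cnj y))"
  unfolding of_real_norm_hardy hardy_cinner_kernel_sum[OF assms(2)] sum_distrib_left
    times_divide_eq_right[symmetric]
proof (rule sum.cong[OF refl])
  fix x assume "x \<in> F"
  then have "hardy_eval (kernel_sum F c) x = (\<Sum>y\<in>F. c y / (1 - x * cnj y))"
    using assms by (intro hardy_eval_kernel_sum) auto
  then show "cnj (c x) * hardy_eval (kernel_sum F c) x = (\<Sum>y\<in>F. cnj (c x) * (c y / (1 - x * cnj y)))"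
    by (simp add: sum_distrib_left)
qed

text \<open>The Pick kernel of a Moebius function has rank one.\<close>

lemma norm_kernel_sum_Moebius_function:
  assumes a: "a \<in> unit_disk" and F: "finite F" "F \<subseteq> unit_disk"
  shows "(norm (kernel_sum F (\<lambda>x. c x * cnj (Moebius_function 0 a x))))\<^sup>2
    = (norm (kernel_sum F c))\<^sup>2 - (1 - (cmod a)\<^sup>2) * (cmod (hardy_eval (kernel_sum F c) a))\<^sup>2"
proof -
  let ?\<phi> = "Moebius_function 0 a"
  define v where "v = kernel_sum F c"
  have v: "hardy_eval v a = (\<Sum>y\<in>F. c y / (1 - a * cnj y))"
    unfolding v_def by (rule hardy_eval_kernel_sum[OF F a])
  have cnj_v: "cnj (hardy_eval v a) = (\<Sum>x\<in>F. cnj (c x) / (1 - cnj a * x))"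
    unfolding v cnj_sum by simp
  have "complex_of_real ((norm v)\<^sup>2) - complex_of_real ((norm (kernel_sum F (\<lambda>x. c x * cnj (?\<phi> x))))\<^sup>2)
      = (\<Sum>x\<in>F. \<Sum>y\<in>F. cnj (c x) * c y * ((1 - ?\<phi> x * cnj (?\<phi> y)) / (1 - x * cnj y)))"
    unfolding v_def norm_kernel_sum[OF F] sum_subtractf[symmetric]
    by (intro sum.cong refl) (simp add: algebra_simps diff_divide_distrib)
  also have "\<dots> = (\<Sum>x\<in>F. \<Sum>y\<in>F. (1 - a * cnj a) * ((cnj (c x) / (1 - cnj a * x)) * (c y / (1 - a * cnj y))))"
  proof (intro sum.cong refl)
    fix x y assume "x \<in> F" "y \<in> F"
    then have xy: "x \<in> unit_disk" "y \<in> unit_disk" using F by auto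
    have "(1 - ?\<phi> x * cnj (?\<phi> y)) / (1 - x * cnj y) = (1 - a * cnj a) / ((1 - cnj a * x) * (1 - a * cnj y))"
      unfolding one_minus_Moebius_function[OF a xy]
      using one_minus_mult_cnj_nonzero[OF xy] by simp
    then show "cnj (c x) * c y * ((1 - ?\<phi> x * cnj (?\<phi> y)) / (1 - x * cnj y))
        = (1 - a * cnj a) * ((cnj (c x) / (1 - cnj a * x)) * (c y / (1 - a * cnj y)))"
      by simp
  qed
  also have "\<dots> = (1 - a * cnj a) * (cnj (hardy_eval v a) * hardy_eval v a)"
    unfolding cnj_v unfolding v unfolding sum_product unfolding sum_distrib_left ..
  also have "\<dots> = complex_of_real ((1 - (cmod a)\<^sup>2) * (cmod (hardy_eval v a))\<^sup>2)"
    using complex_norm_square[of a] complex_norm_square[of "hardy_eval v a"]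
    by (simp add: mult.commute)
  finally have "complex_of_real ((norm (kernel_sum F (\<lambda>x. c x * cnj (?\<phi> x))))\<^sup>2)
      = complex_of_real ((norm v)\<^sup>2 - (1 - (cmod a)\<^sup>2) * (cmod (hardy_eval v a))\<^sup>2)"
    unfolding of_real_diff by (simp add: algebra_simps)
  then show ?thesis unfolding of_real_eq_iff v_def .
qed

lemma norm_square_less_1_unit_disk: "a \<in> unit_disk \<Longrightarrow> (cmod a)\<^sup>2 < 1"
  by (simp add: abs_square_less_1)

text \<open>The term subtracted in \<open>norm_kernel_sum_Moebius_function\<close> is nonnegative,
  which gives Pick positivity.\<close>

lemma Moebius_function_contractive_multiplier:
  assumes A: "A \<subseteq> unit_disk" and a: "a \<in> unit_disk"
  shows "restrict (Moebius_function 0 a) A \<in> multipliers A"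
    "multiplier_norm A (restrict (Moebius_function 0 a) A) \<le> 1"
proof -
  have "pick_positive A (restrict (Moebius_function 0 a) A)"
    unfolding pick_positive_def
  proof (intro allI impI)
    fix F c assume F: "finite F" "F \<subseteq> A"
    have "kernel_sum F (\<lambda>x. c x * cnj (restrict (Moebius_function 0 a) A x))
        = kernel_sum F (\<lambda>x. c x * cnj (Moebius_function 0 a x))"
      unfolding kernel_sum_def using F by (intro sum.cong) auto
    moreover have "(norm (kernel_sum F (\<lambda>x. c x * cnj (Moebius_function 0 a x))))\<^sup>2 \<le> (norm (kernel_sum F c))\<^sup>2"
      using norm_kernel_sum_Moebius_function[OF a F(1), of c] F A norm_square_less_1_unit_disk[OF a] by simp
    ultimately show "norm (kernel_sum F (\<lambda>x. c x * cnj (restrict (Moebius_function 0 a) A x))) \<le> norm (kernel_sum F c)"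
      by (auto intro: power2_le_imp_le)
  qed
  then show "restrict (Moebius_function 0 a) A \<in> multipliers A"
    "multiplier_norm A (restrict (Moebius_function 0 a) A) \<le> 1"
    using pick_positive_contractive_multiplier[OF A] by auto
qed

text \<open>Since \<open>f a = 0\<close>, the coefficient of the kernel function at \<open>a\<close> is at our disposal. It is
  chosen to make the rank one correction in \<open>norm_kernel_sum_Moebius_function\<close> vanish.\<close>

lemma divide_by_Moebius_function:
  assumes a: "a \<in> unit_disk" and fa: "hardy_eval f a = 0"
  obtains e where "norm e \<le> norm f"
    "\<And>x. x \<in> unit_disk \<Longrightarrow> hardy_eval f x = Moebius_function 0 a x * hardy_eval e x"
proof -
  let ?\<phi> = "Moebius_function 0 a"
  \<comment> \<open>The point \<open>a\<close> is left out because the quotient is 0/0 there; at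
    \<open>a\<close> both sides of the factorization vanish.\<close>
  have "kernel_bound (unit_disk - {a}) (\<lambda>x. hardy_eval f x / ?\<phi> x) (norm f)"
  proof (rule kernel_boundI)
    fix F c assume F: "finite F" "F \<subseteq> unit_disk - {a}"
    then have F': "finite (insert a F)" "insert a F \<subseteq> unit_disk" "a \<notin> F" "F \<subseteq> unit_disk"
      using a by auto
    define s where "s = (\<Sum>y\<in>F. c y / cnj (?\<phi> y) / (1 - a * cnj y))"
    define d where "d x = (if x = a then - s * (1 - a * cnj a) else c x / cnj (?\<phi> x))" for x
    define v where "v = kernel_sum (insert a F) d"
    have d: "d x = c x / cnj (?\<phi> x)" "?\<phi> x \<noteq> 0" if "x \<in> F" for x
      using that F Moebius_function_eq_0_iff[OF a, of x] by (auto simp: d_def)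
    have "hardy_eval v a = d a / (1 - a * cnj a) + (\<Sum>y\<in>F. d y / (1 - a * cnj y))"
      unfolding v_def hardy_eval_kernel_sum[OF F'(1,2) a] using F' by simp
    also have "(\<Sum>y\<in>F. d y / (1 - a * cnj y)) = s"
      unfolding s_def by (intro sum.cong) (auto simp: d)
    also have "d a / (1 - a * cnj a) + s = 0"
      using one_minus_mult_cnj_nonzero[OF a a] by (simp add: d_def)
    finally have "norm (kernel_sum (insert a F) (\<lambda>x. d x * cnj (?\<phi> x))) = norm v"
      using norm_kernel_sum_Moebius_function[OF a F'(1,2), of d]
      by (simp add: v_def power2_eq_iff_nonneg)
    moreover have "kernel_sum (insert a F) (\<lambda>x. d x * cnj (?\<phi> x)) = kernel_sum F c"
      unfolding kernel_sum_def using F' d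
      by (auto simp: Moebius_function_eq_zero intro!: sum.cong)
    ultimately have norm_v: "norm v = norm (kernel_sum F c)" by simp
    have "hardy_cinner f v = (\<Sum>x\<in>insert a F. cnj (d x) * hardy_eval f x)"
      unfolding v_def by (rule hardy_cinner_kernel_sum[OF F'(2)])
    also have "\<dots> = (\<Sum>x\<in>F. cnj (c x) * (hardy_eval f x / ?\<phi> x))"
      using F' by (auto simp: fa d intro!: sum.cong)
    finally show "cmod (\<Sum>x\<in>F. cnj (c x) * (hardy_eval f x / ?\<phi> x)) \<le> norm f * norm (kernel_sum F c)"
      using norm_hardy_cinner_le[of f v] by (simp add: norm_v)
  qed
  then obtain e where e: "norm e \<le> norm f"
    "\<And>x. x \<in> unit_disk - {a} \<Longrightarrow> hardy_eval e x = hardy_eval f x / ?\<phi> x"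
    by (rule kernel_bound_imp_eval[rotated 2]) auto
  show thesis
  proof (rule that[OF e(1)])
    fix x assume x: "x \<in> unit_disk"
    show "hardy_eval f x = ?\<phi> x * hardy_eval e x"
      using e(2)[of x] fa x Moebius_function_eq_0_iff[OF a x]
      by (cases "x = a") (auto simp: Moebius_function_eq_zero)
  qed
qed

text \<open>A point outside the hull yields a nonzero Hardy space function \<open>g\<close>
  vanishing on \<open>A\<close>. If everything vanishing on \<open>A - {a}\<close> also vanished at
  \<open>a\<close>, then \<open>g\<close> could be divided by the Moebius function at
  \<open>a\<close> any number of times without increase of norm, forcing
  \<open>g = 0\<close>.\<close>

lemma hardy_separating_function:
  assumes A: "A \<subseteq> unit_disk" "A \<noteq> unit_disk" and hull: "hardy_hull A = A" and a: "a \<in> A"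
  obtains f where "hardy_eval f a = 1" "\<And>x. x \<in> A - {a} \<Longrightarrow> hardy_eval f x = 0"
proof -
  let ?\<phi> = "Moebius_function 0 a"
  have aD: "a \<in> unit_disk" using a A by blast
  obtain x where x: "x \<in> unit_disk" "x \<notin> A" using A by blast
  then have kx: "hardy_kernel x \<notin> hardy_sub A"
    using hull by (auto simp: hardy_hull_def)
  \<comment> \<open>\<open>w\<close> is the orthogonal projection of the kernel function at
    \<open>x\<close> to \<open>hardy_sub A\<close>. The difference \<open>g\<close> vanishes on
    \<open>A\<close> and is nonzero by \<open>kx\<close>.\<close>
  obtain w where w: "w \<in> hardy_sub A" "\<And>y. y \<in> A \<Longrightarrow> hardy_eval w y = hardy_eval (hardy_kernel x) y"
    using kernel_bound_imp_eval[OF A(1) norm_ge_zero kernel_bound_eval[OF A(1), of "hardy_kernel x"]]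
    by metis
  define g where "g = hardy_kernel x - w"
  have g: "hardy_eval g y = 0" if "y \<in> A" for y
    using that A w(2)[OF that] by (auto simp: g_def hardy_eval_diff subset_iff)
  have "\<exists>f. hardy_eval f a \<noteq> 0 \<and> (\<forall>x\<in>A - {a}. hardy_eval f x = 0)"
  proof (rule ccontr)
    assume "\<not> ?thesis"
    then have van: "hardy_eval f a = 0" if "\<And>x. x \<in> A - {a} \<Longrightarrow> hardy_eval f x = 0" for f
      using that by blast
    have factor: "\<exists>e. norm e \<le> norm g \<and> (\<forall>y\<in>A - {a}. hardy_eval e y = 0)
        \<and> (\<forall>y\<in>unit_disk. hardy_eval g y = ?\<phi> y ^ n * hardy_eval e y)" for n
    proof (induction n)
      case 0
      show ?case using g by (intro exI[of _ g]) auto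
    next
      case (Suc n)
      then obtain e where e: "norm e \<le> norm g" "\<And>y. y \<in> A - {a} \<Longrightarrow> hardy_eval e y = 0"
        "\<And>y. y \<in> unit_disk \<Longrightarrow> hardy_eval g y = ?\<phi> y ^ n * hardy_eval e y"
        by blast
      obtain e' where e': "norm e' \<le> norm e"
        "\<And>y. y \<in> unit_disk \<Longrightarrow> hardy_eval e y = ?\<phi> y * hardy_eval e' y"
        using divide_by_Moebius_function[OF aD van[OF e(2)]] by blast
      have "hardy_eval e' y = 0" if y: "y \<in> A - {a}" for y
      proof -
        have yD: "y \<in> unit_disk" using y A by blast
        have "?\<phi> y * hardy_eval e' y = 0" using e'(2)[OF yD] e(2)[OF y] by simp
        then show ?thesis using Moebius_function_eq_0_iff[OF aD yD] y by auto
      qed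
      then show ?case using e e' by (intro exI[of _ e']) (auto simp: mult_ac)
    qed
    have "hardy_eval g y = 0" if y: "y \<in> unit_disk" for y
    proof -
      have "cmod (hardy_eval g y) \<le> cmod (?\<phi> y) ^ n * (norm g * norm (hardy_kernel y))" for n
      proof -
        obtain e where e: "norm e \<le> norm g" "hardy_eval g y = ?\<phi> y ^ n * hardy_eval e y"
          using factor[of n] y by blast
        have "cmod (hardy_eval e y) \<le> norm e * norm (hardy_kernel y)"
          using norm_hardy_cinner_le[of e "hardy_kernel y"] y by (simp add: hardy_reproducing)
        also have "\<dots> \<le> norm g * norm (hardy_kernel y)"
          using e by (intro mult_right_mono) auto
        finally show ?thesis
          unfolding e(2) norm_mult norm_power by (intro mult_left_mono) auto
      qed
      \<comment> \<open>The Moebius function has modulus below 1 at \<open>y\<close>, while the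
        quotients have norms bounded by \<open>norm g\<close>.\<close>
      moreover have "(\<lambda>n. cmod (?\<phi> y) ^ n * (norm g * norm (hardy_kernel y))) \<longlonglongrightarrow> 0 * (norm g * norm (hardy_kernel y))"
        using Moebius_function_in_unit_disk[OF aD y, of 0] by (intro tendsto_mult tendsto_const LIMSEQ_realpow_zero) auto
      ultimately have "cmod (hardy_eval g y) \<le> 0"
        by (intro LIMSEQ_le_const) auto
      then show ?thesis by simp
    qed
    then have "hardy_eval w y = hardy_eval (hardy_kernel x) y" if "y \<in> unit_disk" for y
      using hardy_eval_diff[OF that, of "hardy_kernel x" w] that by (simp only: g_def) simp
    then have "hardy_restrict unit_disk w = hardy_restrict unit_disk (hardy_kernel x)"
      unfolding hardy_restrict_def by (rule restrict_ext)
    moreover have "hardy_sub A \<subseteq> hardy_sub unit_disk"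
      unfolding hardy_sub_def using A by (intro closure_mono hardy.span_mono image_mono)
    moreover have "hardy_kernel x \<in> hardy_sub unit_disk"
      unfolding hardy_sub_def
      by (rule subsetD[OF closure_subset hardy.span_base[OF imageI[OF x(1)]]])
    ultimately have "w = hardy_kernel x"
      using inj_onD[OF inj_on_hardy_restrict[OF subset_refl], of w "hardy_kernel x"] w(1) by blast
    then show False using kx w(1) by simp
  qed
  then obtain f where f: "hardy_eval f a \<noteq> 0" "\<forall>x\<in>A - {a}. hardy_eval f x = 0" by blast
  show thesis
  proof
    show "hardy_eval (hardy_scale (inverse (hardy_eval f a)) f) a = 1"
      using f aD by (simp add: hardy_eval_scale)
    fix y assume y: "y \<in> A - {a}"
    then have "y \<in> unit_disk" using A by blast
    then show "hardy_eval (hardy_scale (inverse (hardy_eval f a)) f) y = 0"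
      using f y by (simp add: hardy_eval_scale)
  qed
qed

lemma continuous_hardy_eval:
  assumes "x \<in> unit_disk"
  shows "isCont (hardy_eval f) x"
proof -
  \<comment> \<open>A real number strictly between \<open>cmod x\<close> and 1. The series converges
    at \<open>K\<close>, being the inner product with the kernel function there, so it is continuous
    at the smaller modulus.\<close>
  define K where "K = complex_of_real ((1 + cmod x) / 2)"
  have nK: "cmod K = (1 + cmod x) / 2" by (simp only: K_def norm_of_real) simp
  then have K: "K \<in> unit_disk" "cmod x < cmod K" using assms by auto
  have "summable (\<lambda>n. hardy_coeff f n * K ^ n)"
    using hardy_cinner_summable[of f "hardy_kernel K"] by (simp add: hardy_coeff_kernel[OF K(1)])
  then show ?thesis
    unfolding hardy_eval_def[abs_def] using K(2) by (rule isCont_powser)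
qed

lemma hardy_eval_eq_0_if_eq_0_off_point:
  assumes a: "a \<in> unit_disk" and f: "\<And>x. x \<in> unit_disk - {a} \<Longrightarrow> hardy_eval f x = 0"
  shows "hardy_eval f a = 0"
proof (rule LIM_unique)
  show "hardy_eval f \<midarrow>a\<rightarrow> hardy_eval f a"
    using continuous_hardy_eval[OF a] by (simp add: isCont_def)
  have "eventually (\<lambda>x. x \<in> unit_disk - {a}) (at a)"
    using a by (intro eventually_at_in_open) auto
  then have "eventually (\<lambda>x. 0 = hardy_eval f x) (at a)"
    by (rule eventually_mono) (simp only: f)
  then show "hardy_eval f \<midarrow>a\<rightarrow> 0"
    by (rule Lim_transform_eventually[OF tendsto_const])
qed

section \<open>Point functions as multipliers\<close>

definition point_function :: "complex set \<Rightarrow> complex \<Rightarrow> complex \<Rightarrow> complex"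
  where "point_function A a = (\<lambda>x\<in>A. if x = a then 1 else 0)"

text \<open>Multiplication by the point function sends \<open>h\<close> to \<open>h a\<close> times
  the restriction of the separating function.\<close>

lemma point_function_multiplier:
  assumes A: "A \<subseteq> unit_disk" "A \<noteq> unit_disk" and hull: "hardy_hull A = A" and a: "a \<in> A"
  shows "point_function A a \<in> multipliers A"
proof -
  obtain f where f: "hardy_eval f a = 1" "\<And>x. x \<in> A - {a} \<Longrightarrow> hardy_eval f x = 0"
    using hardy_separating_function[OF assms] by blast
  have eq: "(\<lambda>x\<in>A. point_function A a x * h x) = (\<lambda>x\<in>A. h a * hardy_restrict A f x)" for h
  proof (rule restrict_ext)
    fix x assume "x \<in> A"
    then show "point_function A a x * h x = h a * hardy_restrict A f x"
      using f by (cases "x = a") (simp_all add: point_function_def hardy_restrict_def)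
  qed
  have "(\<lambda>x\<in>A. h a * hardy_restrict A f x) \<in> hardy_on A" for h
    by (rule hardy_on_scale[OF A(1) hardy_restrict_in_hardy_on(1)[OF A(1)]])
  moreover have "point_function A a \<in> extensional A"
    by (simp add: point_function_def)
  ultimately show ?thesis by (simp add: multipliers_def eq)
qed

lemma const_multiplier: "A \<subseteq> unit_disk \<Longrightarrow> (\<lambda>x\<in>A. c) \<in> multipliers A"
proof -
  have "(\<lambda>x\<in>A. (\<lambda>x\<in>A. c) x * h x) = (\<lambda>x\<in>A. c * h x)" for h
    by (rule restrict_ext) simp
  then show "A \<subseteq> unit_disk \<Longrightarrow> (\<lambda>x\<in>A. c) \<in> multipliers A"
    by (simp add: multipliers_def hardy_on_scale)
qed

lemma identity_multiplier: "A \<subseteq> unit_disk \<Longrightarrow> (\<lambda>x\<in>A. x) \<in> multipliers A"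
proof -
  assume A: "A \<subseteq> unit_disk"
  have "restrict (Moebius_function 0 0) A = (\<lambda>x\<in>A. x)"
    by (rule restrict_ext) (simp add: Moebius_function_simple)
  with Moebius_function_contractive_multiplier(1)[OF A, of 0] show ?thesis by simp
qed

text \<open>Applied to the constant 1, which is the kernel function at 0, such a multiplier would
  produce a Hardy space function discontinuous at \<open>a\<close>.\<close>

lemma point_function_not_multiplier_unit_disk:
  assumes "a \<in> unit_disk"
  shows "point_function unit_disk a \<notin> multipliers unit_disk"
proof
  let ?D = "unit_disk :: complex set"
  assume mult: "point_function ?D a \<in> multipliers ?D"
  have one: "hardy_eval (hardy_kernel 0) x = 1" if "x \<in> ?D" for x
    using that by (simp add: hardy_eval_kernel)
  have "(\<lambda>x\<in>?D. point_function ?D a x * hardy_restrict ?D (hardy_kernel 0) x) \<in> hardy_on ?D"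
    by (rule multipliersD[OF mult hardy_restrict_in_hardy_on(1)]) simp
  then obtain f where f: "hardy_restrict ?D f = (\<lambda>x\<in>?D. point_function ?D a x * hardy_restrict ?D (hardy_kernel 0) x)"
    by (auto simp: hardy_on_def)
  have f_eq: "hardy_eval f x = (if x = a then 1 else 0)" if "x \<in> ?D" for x
    using fun_cong[OF f, of x] that one[OF that] by (simp add: hardy_restrict_def point_function_def)
  have "hardy_eval f a = 0"
  proof (rule hardy_eval_eq_0_if_eq_0_off_point[OF assms])
    fix x assume "x \<in> unit_disk - {a}"
    then show "hardy_eval f x = 0" using f_eq[of x] by simp
  qed
  then show False using f_eq[OF assms] by simp
qed

section \<open>Disk automorphisms\<close>

lemma disk_automorphismI:
  assumes \<phi>: "\<phi> holomorphic_on unit_disk" "\<And>z. z \<in> unit_disk \<Longrightarrow> \<phi> z \<in> unit_disk"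
    and \<psi>: "\<psi> holomorphic_on unit_disk" "\<And>z. z \<in> unit_disk \<Longrightarrow> \<psi> z \<in> unit_disk"
    and inverse: "\<And>z. z \<in> unit_disk \<Longrightarrow> \<psi> (\<phi> z) = z" "\<And>z. z \<in> unit_disk \<Longrightarrow> \<phi> (\<psi> z) = z"
  shows "disk_automorphism \<phi>"
proof -
  have bij: "bij_betw \<phi> unit_disk unit_disk"
    by (rule bij_betw_byWitness[where f' = \<psi>]) (use assms in auto)
  have "the_inv_into unit_disk \<phi> z = \<psi> z" if z: "z \<in> unit_disk" for z
    by (rule the_inv_into_f_eq[OF bij_betw_imp_inj_on[OF bij] inverse(2)[OF z] \<psi>(2)[OF z]])
  then have "the_inv_into unit_disk \<phi> holomorphic_on unit_disk"
    using holomorphic_cong[OF refl, of unit_disk "the_inv_into unit_disk \<phi>" \<psi>] \<psi>(1) by blast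
  then show ?thesis using bij \<phi>(1) by (simp add: disk_automorphism_def)
qed

text \<open>Composition with the Moebius function taking 0 to \<open>\<psi> 0\<close> gives a map
  \<open>f\<close> fixing 0. By the Schwarz lemma neither \<open>f\<close> nor its left inverse
  \<open>g\<close> raises moduli, so \<open>f\<close> preserves the modulus of the nonzero point
  \<open>1/2\<close> and is a rotation.\<close>

lemma disk_automorphism_Moebius_function:
  assumes "disk_automorphism \<phi>"
  obtains a \<beta> where "a \<in> unit_disk" "cmod \<beta> = 1"
    "\<And>z. z \<in> unit_disk \<Longrightarrow> \<phi> z = \<beta> * Moebius_function 0 a z"
proof -
  define \<psi> where "\<psi> = the_inv_into unit_disk \<phi>"
  have bij: "bij_betw \<phi> unit_disk unit_disk" and hol: "\<phi> holomorphic_on unit_disk" "\<psi> holomorphic_on unit_disk"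
    using assms by (auto simp: disk_automorphism_def \<psi>_def)
  have \<phi>: "\<phi> z \<in> unit_disk" if "z \<in> unit_disk" for z
    using bij_betw_apply[OF bij that] .
  have \<psi>: "\<psi> z \<in> unit_disk" if "z \<in> unit_disk" for z
    using bij_betw_apply[OF bij_betw_the_inv_into[OF bij] that] by (simp add: \<psi>_def)
  have \<phi>\<psi>: "\<phi> (\<psi> z) = z" if "z \<in> unit_disk" for z
    unfolding \<psi>_def by (rule f_the_inv_into_f_bij_betw[OF bij that])
  have \<psi>\<phi>: "\<psi> (\<phi> z) = z" if "z \<in> unit_disk" for z
    unfolding \<psi>_def by (rule the_inv_into_f_f[OF bij_betw_imp_inj_on[OF bij] that])
  have zero: "0 \<in> unit_disk" by simp
  define a where "a = \<psi> 0"
  have a: "a \<in> unit_disk" "- a \<in> unit_disk" using \<psi>[OF zero] by (simp_all add: a_def)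
  define f where "f = \<phi> \<circ> Moebius_function 0 (- a)"
  define g where "g = Moebius_function 0 a \<circ> \<psi>"
  have m: "Moebius_function 0 w holomorphic_on unit_disk" if "w \<in> unit_disk" for w
    by (rule Moebius_function_holomorphic) (use that in simp)
  have hol_f: "f holomorphic_on unit_disk"
    unfolding f_def by (rule holomorphic_on_compose_gen[OF m[OF a(2)] hol(1)])
      (use Moebius_function_in_unit_disk[OF a(2)] in blast)
  have hol_g: "g holomorphic_on unit_disk"
    unfolding g_def by (rule holomorphic_on_compose_gen[OF hol(2) m[OF a(1)]])
      (use \<psi> in blast)
  have f0: "f 0 = 0"
    using \<phi>\<psi>[OF zero] by (simp add: f_def Moebius_function_of_zero a_def)
  have g0: "g 0 = 0"
    by (simp add: g_def Moebius_function_eq_zero flip: a_def)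
  have f: "f z \<in> unit_disk" if "z \<in> unit_disk" for z
    using \<phi>[OF Moebius_function_in_unit_disk[OF a(2) that]] by (simp add: f_def)
  have g: "g z \<in> unit_disk" if "z \<in> unit_disk" for z
    using Moebius_function_in_unit_disk[OF a(1) \<psi>[OF that]] by (simp add: g_def)
  have gf: "g (f z) = z" if z: "z \<in> unit_disk" for z
    using \<psi>\<phi>[OF Moebius_function_in_unit_disk[OF a(2) z]] Moebius_function_inverse(2)[OF a(1) z]
    by (simp add: f_def g_def)
  have f1: "cmod (f z) < 1" if "cmod z < 1" for z using f[of z] that by simp
  have g1: "cmod (g z) < 1" if "cmod z < 1" for z using g[of z] that by simp
  have half: "cmod (1/2) < 1" by simp
  have "cmod (f (1/2)) \<le> cmod (1/2)"
    by (rule Schwarz_Lemma(1)[OF hol_f f0 f1 half])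
  moreover have "cmod (g (f (1/2))) \<le> cmod (f (1/2))"
    by (rule Schwarz_Lemma(1)[OF hol_g g0 g1 f1[OF half]])
  ultimately have "cmod (f (1/2)) = cmod (1/2)"
    using gf[of "1/2"] by simp
  then have "\<exists>z. cmod z < 1 \<and> z \<noteq> 0 \<and> cmod (f z) = cmod z"
    by (intro exI[of _ "1/2"]) simp
  then obtain \<beta> where \<beta>: "\<And>z. cmod z < 1 \<Longrightarrow> f z = \<beta> * z" "cmod \<beta> = 1"
    using Schwarz_Lemma(3)[OF hol_f f0 f1 half] by blast
  show thesis
  proof (rule that[OF a(1) \<beta>(2)])
    fix z assume z: "z \<in> unit_disk"
    have "\<phi> z = f (Moebius_function 0 a z)"
      by (simp add: f_def Moebius_function_inverse(1)[OF a(1) z])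
    also have "\<dots> = \<beta> * Moebius_function 0 a z"
      using Moebius_function_in_unit_disk[OF a(1) z] by (intro \<beta>(1)) simp
    finally show "\<phi> z = \<beta> * Moebius_function 0 a z" .
  qed
qed

text \<open>The assumptions say that \<open>h \<mapsto> u * (h \<circ> \<phi>)\<close> is unitary from \<open>hardy_on B\<close> onto
  \<open>hardy_on A\<close>.\<close>

locale kernel_isomorphism =
  fixes A B :: "complex set" and \<phi> \<psi> u :: "complex \<Rightarrow> complex"
  assumes A: "A \<subseteq> unit_disk" and B: "B \<subseteq> unit_disk"
    and \<phi>: "x \<in> A \<Longrightarrow> \<phi> x \<in> B" and \<psi>: "y \<in> B \<Longrightarrow> \<psi> y \<in> A"
    and \<psi>\<phi>: "x \<in> A \<Longrightarrow> \<psi> (\<phi> x) = x" and \<phi>\<psi>: "y \<in> B \<Longrightarrow> \<phi> (\<psi> y) = y"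
    and u: "x \<in> A \<Longrightarrow> u x \<noteq> 0"
    and covariant: "x \<in> A \<Longrightarrow> y \<in> A \<Longrightarrow>
      u x * cnj (u y) / (1 - \<phi> x * cnj (\<phi> y)) = 1 / (1 - x * cnj y)"
begin

definition pullback :: "(complex \<Rightarrow> complex) \<Rightarrow> complex \<Rightarrow> complex"
  where "pullback h = (\<lambda>x\<in>A. u x * h (\<phi> x))"

text \<open>Makes the setting symmetric, so that inequalities turn into equalities when applied to
  the inverse as well.\<close>

lemma inverse: "kernel_isomorphism B A \<psi> \<phi> (\<lambda>y. 1 / u (\<psi> y))"
proof
  fix x y assume xy: "x \<in> B" "y \<in> B"
  have "u (\<psi> x) * cnj (u (\<psi> y)) * (1 / (1 - x * cnj y)) = 1 / (1 - \<psi> x * cnj (\<psi> y))"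
    using covariant[OF \<psi>[OF xy(1)] \<psi>[OF xy(2)]] by (simp add: \<phi>\<psi> xy)
  moreover have "1 / u (\<psi> x) * cnj (1 / u (\<psi> y)) / (1 - \<psi> x * cnj (\<psi> y))
      = 1 / (u (\<psi> x) * cnj (u (\<psi> y))) * (1 / (1 - \<psi> x * cnj (\<psi> y)))"
    by simp
  moreover have "u (\<psi> x) * cnj (u (\<psi> y)) \<noteq> 0"
    using u[OF \<psi>[OF xy(1)]] u[OF \<psi>[OF xy(2)]] by simp
  then have "1 / (u (\<psi> x) * cnj (u (\<psi> y))) * (u (\<psi> x) * cnj (u (\<psi> y)) * z) = z" for z
    by simp
  ultimately show "1 / u (\<psi> x) * cnj (1 / u (\<psi> y)) / (1 - \<psi> x * cnj (\<psi> y)) = 1 / (1 - x * cnj y)"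
    by metis
qed (use A B \<phi> \<psi> \<psi>\<phi> \<phi>\<psi> u in auto)

lemma kernel_bound_pullback:
  assumes h: "kernel_bound B h r"
  shows "kernel_bound A (pullback h) r"
proof (rule kernel_boundI)
  fix F c assume F: "finite F" "F \<subseteq> A"
  \<comment> \<open>The adjoint of \<open>pullback\<close> on coefficients: \<open>x\<close> moves
    to \<open>\<phi> x\<close> and picks up the factor \<open>cnj (u x)\<close>. By
    \<open>covariant\<close> this preserves the norm of the kernel sum.\<close>
  define d where "d y = cnj (u (\<psi> y)) * c (\<psi> y)" for y
  have G: "finite (\<phi> ` F)" "\<phi> ` F \<subseteq> B" using F \<phi> by auto
  have inj: "inj_on \<phi> F" using F \<psi>\<phi> by (intro inj_on_inverseI[of _ \<psi>]) auto
  have d: "d (\<phi> x) = cnj (u x) * c x" if "x \<in> F" for x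
    using that F \<psi>\<phi>[of x] by (auto simp: d_def)
  have "(\<Sum>x\<in>F. cnj (c x) * pullback h x) = (\<Sum>y\<in>\<phi> ` F. cnj (d y) * h y)"
    unfolding sum.reindex[OF inj] o_def
    using F by (intro sum.cong refl) (auto simp: d pullback_def)
  moreover have "norm (kernel_sum (\<phi> ` F) d) = norm (kernel_sum F c)"
  proof -
    have "complex_of_real ((norm (kernel_sum (\<phi> ` F) d))\<^sup>2)
        = (\<Sum>x\<in>F. \<Sum>y\<in>F. cnj (d (\<phi> x)) * d (\<phi> y) / (1 - \<phi> x * cnj (\<phi> y)))"
      using G B by (simp only: norm_kernel_sum subset_trans[OF G(2) B] sum.reindex[OF inj] o_def)
    also have "\<dots> = (\<Sum>x\<in>F. \<Sum>y\<in>F. cnj (c x) * c y * (u x * cnj (u y) / (1 - \<phi> x * cnj (\<phi> y))))"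
      by (intro sum.cong refl) (simp add: d)
    also have "\<dots> = (\<Sum>x\<in>F. \<Sum>y\<in>F. cnj (c x) * c y / (1 - x * cnj y))"
      using F(2) by (intro sum.cong refl) (auto simp: covariant subset_iff)
    also have "\<dots> = complex_of_real ((norm (kernel_sum F c))\<^sup>2)"
      using F A by (intro norm_kernel_sum[symmetric]) auto
    finally show ?thesis
      unfolding of_real_eq_iff by (simp add: power2_eq_iff_nonneg)
  qed
  ultimately show "cmod (\<Sum>x\<in>F. cnj (c x) * pullback h x) \<le> r * norm (kernel_sum F c)"
    using kernel_boundD[OF h G, of d] by simp
qed

lemma pullback_le:
  assumes "h \<in> hardy_on B"
  shows "pullback h \<in> hardy_on A" "hardy_on_norm A (pullback h) \<le> hardy_on_norm B h"
  using kernel_bound_pullback[OF kernel_bound_hardy_on_norm[OF B assms]]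
    hardy_on_kernel_bound_iff[OF A hardy_on_norm_nonneg[OF B assms], of "pullback h"]
  by (auto simp: pullback_def)

end

lemma (in kernel_isomorphism) hardy_on_norm_pullback:
  assumes h: "h \<in> hardy_on B"
  shows "hardy_on_norm A (pullback h) = hardy_on_norm B h"
proof (rule antisym)
  interpret inv: kernel_isomorphism B A \<psi> \<phi> "\<lambda>y. 1 / u (\<psi> y)" by (rule inverse)
  have "inv.pullback (pullback h) = h"
    using hardy_on_extensional[OF h] u \<phi>\<psi> \<psi>
    by (intro extensionalityI[of _ B]) (auto simp: pullback_def inv.pullback_def)
  then show "hardy_on_norm B h \<le> hardy_on_norm A (pullback h)"
    using inv.pullback_le(2)[OF pullback_le(1)[OF h]] by simp
qed (rule pullback_le(2)[OF h])

text \<open>\<open>pullback\<close> conjugates multiplication by \<open>f \<circ> \<psi>\<close> on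
  \<open>B\<close> into multiplication by \<open>f\<close> on \<open>A\<close>. The second claim
  compares the sets under the supremum; together with its counterpart for the inverse it makes these
  sets equal.\<close>

lemma (in kernel_isomorphism) multiplier_transfer:
  assumes f: "f \<in> multipliers A"
  shows "(\<lambda>y\<in>B. f (\<psi> y)) \<in> multipliers B" (is "?g \<in> _")
    and "{hardy_on_norm B (\<lambda>y\<in>B. (\<lambda>y\<in>B. f (\<psi> y)) y * h y) | h. h \<in> hardy_on B \<and> hardy_on_norm B h \<le> 1}
      \<subseteq> {hardy_on_norm A (\<lambda>x\<in>A. f x * h x) | h. h \<in> hardy_on A \<and> hardy_on_norm A h \<le> 1}"
proof -
  interpret inv: kernel_isomorphism B A \<psi> \<phi> "\<lambda>y. 1 / u (\<psi> y)" by (rule inverse)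
  have eq: "(\<lambda>y\<in>B. ?g y * h y) = inv.pullback (\<lambda>x\<in>A. f x * pullback h x)" for h
    unfolding inv.pullback_def
    by (rule restrict_ext) (simp add: pullback_def \<psi> u \<phi>\<psi>)
  have on: "(\<lambda>x\<in>A. f x * pullback h x) \<in> hardy_on A" if "h \<in> hardy_on B" for h
    using f pullback_le(1)[OF that] by (rule multipliersD)
  show "?g \<in> multipliers B"
    unfolding multipliers_def
  proof (intro CollectI conjI ballI)
    show "(\<lambda>y\<in>B. ?g y * h y) \<in> hardy_on B" if "h \<in> hardy_on B" for h
      unfolding eq by (rule inv.pullback_le(1)[OF on[OF that]])
  qed simp
  have norm_eq: "hardy_on_norm B (\<lambda>y\<in>B. ?g y * h y) = hardy_on_norm A (\<lambda>x\<in>A. f x * pullback h x)"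
    if "h \<in> hardy_on B" for h
    unfolding eq by (rule inv.hardy_on_norm_pullback[OF on[OF that]])
  have le: "hardy_on_norm A (pullback h) \<le> 1" if "h \<in> hardy_on B" "hardy_on_norm B h \<le> 1" for h
    using pullback_le(2)[OF that(1)] that(2) by linarith
  show "{hardy_on_norm B (\<lambda>y\<in>B. ?g y * h y) | h. h \<in> hardy_on B \<and> hardy_on_norm B h \<le> 1}
      \<subseteq> {hardy_on_norm A (\<lambda>x\<in>A. f x * h x) | h. h \<in> hardy_on A \<and> hardy_on_norm A h \<le> 1}"
    (is "?S \<subseteq> ?T")
  proof
    fix z assume "z \<in> ?S"
    then obtain h where h: "z = hardy_on_norm B (\<lambda>y\<in>B. ?g y * h y)" "h \<in> hardy_on B" "hardy_on_norm B h \<le> 1"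
      by blast
    show "z \<in> ?T"
      unfolding h(1) norm_eq[OF h(2)]
      by (intro CollectI exI[of _ "pullback h"] conjI refl pullback_le(1)[OF h(2)] le[OF h(2,3)])
  qed
qed

lemma (in kernel_isomorphism) multipliers_isometrically_isomorphic:
  "multipliers_isometrically_isomorphic A B"
proof -
  interpret inv: kernel_isomorphism B A \<psi> \<phi> "\<lambda>y. 1 / u (\<psi> y)" by (rule inverse)
  define \<Phi> where "\<Phi> f = (\<lambda>y\<in>B. f (\<psi> y))" for f :: "complex \<Rightarrow> complex"
  define \<Psi> where "\<Psi> g = (\<lambda>x\<in>A. g (\<phi> x))" for g :: "complex \<Rightarrow> complex"
  have \<Psi>\<Phi>: "\<Psi> (\<Phi> f) = f" if "f \<in> extensional A" for f
    using that \<phi> \<psi>\<phi> by (intro extensionalityI[of _ A]) (auto simp: \<Phi>_def \<Psi>_def)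
  have \<Phi>\<Psi>: "\<Phi> (\<Psi> g) = g" if "g \<in> extensional B" for g
    using that \<psi> \<phi>\<psi> by (intro extensionalityI[of _ B]) (auto simp: \<Phi>_def \<Psi>_def)
  have \<Phi>: "\<Phi> f \<in> multipliers B" if "f \<in> multipliers A" for f
    unfolding \<Phi>_def by (rule multiplier_transfer(1)[OF that])
  have \<Psi>: "\<Psi> g \<in> multipliers A" if "g \<in> multipliers B" for g
    unfolding \<Psi>_def by (rule inv.multiplier_transfer(1)[OF that])
  have "multiplier_norm B (\<Phi> f) = multiplier_norm A f" if f: "f \<in> multipliers A" for f
    unfolding multiplier_norm_def
  proof (rule arg_cong[where f = Sup], rule antisym)
    show "{hardy_on_norm B (\<lambda>y\<in>B. \<Phi> f y * h y) | h. h \<in> hardy_on B \<and> hardy_on_norm B h \<le> 1}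
      \<subseteq> {hardy_on_norm A (\<lambda>x\<in>A. f x * h x) | h. h \<in> hardy_on A \<and> hardy_on_norm A h \<le> 1}"
      unfolding \<Phi>_def by (rule multiplier_transfer(2)[OF f])
    show "{hardy_on_norm A (\<lambda>x\<in>A. f x * h x) | h. h \<in> hardy_on A \<and> hardy_on_norm A h \<le> 1}
      \<subseteq> {hardy_on_norm B (\<lambda>y\<in>B. \<Phi> f y * h y) | h. h \<in> hardy_on B \<and> hardy_on_norm B h \<le> 1}"
      using inv.multiplier_transfer(2)[OF \<Phi>[OF f]]
      unfolding \<Psi>_def[symmetric] \<Psi>\<Phi>[OF multipliers_extensional[OF f]] .
  qed
  moreover have "bij_betw \<Phi> (multipliers A) (multipliers B)"
    by (rule bij_betw_byWitness[where f' = \<Psi>])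
      (use \<Phi> \<Psi> \<Phi>\<Psi> \<Psi>\<Phi> multipliers_extensional in auto)
  moreover have "\<Phi> (\<lambda>x\<in>A. f x + g x) = (\<lambda>x\<in>B. \<Phi> f x + \<Phi> g x)" for f g
    unfolding \<Phi>_def by (rule restrict_ext) (simp add: \<psi>)
  moreover have "\<Phi> (\<lambda>x\<in>A. c * f x) = (\<lambda>x\<in>B. c * \<Phi> f x)" for c f
    unfolding \<Phi>_def by (rule restrict_ext) (simp add: \<psi>)
  moreover have "\<Phi> (\<lambda>x\<in>A. f x * g x) = (\<lambda>x\<in>B. \<Phi> f x * \<Phi> g x)" for f g
    unfolding \<Phi>_def by (rule restrict_ext) (simp add: \<psi>)
  ultimately show ?thesis
    unfolding multipliers_isometrically_isomorphic_def by blast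
qed

lemma congruent_imp_isometrically_isomorphic:
  assumes A: "A \<subseteq> unit_disk" and B: "B \<subseteq> unit_disk" and AB: "congruent_in_disk A B"
  shows "multipliers_isometrically_isomorphic A B"
proof -
  obtain \<phi> where aut: "disk_automorphism \<phi>" and im: "\<phi> ` A = B"
    using AB by (auto simp: congruent_in_disk_def)
  obtain a \<beta> where a: "a \<in> unit_disk" and \<beta>: "cmod \<beta> = 1"
    and \<phi>: "\<And>z. z \<in> unit_disk \<Longrightarrow> \<phi> z = \<beta> * Moebius_function 0 a z"
    using disk_automorphism_Moebius_function[OF aut] by blast
  have inj: "inj_on \<phi> A"
    using aut A by (auto simp: disk_automorphism_def bij_betw_def intro: inj_on_subset)
  \<comment> \<open>Chosen so that \<open>u\<close> is the kernel function at \<open>a\<close>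
    divided by its norm; \<open>s * cnj s\<close> is the constant in
    \<open>one_minus_Moebius_function\<close>.\<close>
  define s where "s = complex_of_real (sqrt (1 - (cmod a)\<^sup>2))"
  have s: "s * cnj s = 1 - a * cnj a" "s \<noteq> 0"
    using norm_square_less_1_unit_disk[OF a] complex_norm_square[of a]
    by (auto simp: s_def simp flip: of_real_mult)
  define u where "u x = s / (1 - cnj a * x)" for x
  interpret kernel_isomorphism A B \<phi> "the_inv_into A \<phi>" u
  proof
    show "u x \<noteq> 0" if "x \<in> A" for x
      using one_minus_cnj_mult_nonzero[OF a, of x] that A s by (auto simp: u_def)
    show "u x * cnj (u y) / (1 - \<phi> x * cnj (\<phi> y)) = 1 / (1 - x * cnj y)" if xy: "x \<in> A" "y \<in> A" for x y
    proof -
      have D: "x \<in> unit_disk" "y \<in> unit_disk" using xy A by auto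
      define m where "m = Moebius_function 0 a x * cnj (Moebius_function 0 a y)"
      define k where "k = u x * cnj (u y)"
      have "\<beta> * cnj \<beta> = 1" using \<beta> by (simp flip: complex_norm_square)
      moreover have "\<phi> x * cnj (\<phi> y) = (\<beta> * cnj \<beta>) * m"
        by (simp add: \<phi>[OF D(1)] \<phi>[OF D(2)] m_def)
      ultimately have "\<phi> x * cnj (\<phi> y) = m" by simp
      moreover have "k = (s * cnj s) / ((1 - cnj a * x) * (1 - a * cnj y))"
        by (simp add: k_def u_def)
      then have "1 - m = k * (1 - x * cnj y)" "k \<noteq> 0"
        unfolding m_def one_minus_Moebius_function[OF a D] s(1)
        using one_minus_cnj_mult_nonzero[OF a D(1)] one_minus_mult_cnj_nonzero[OF a D(2)]
          one_minus_mult_cnj_nonzero[OF a a] by simp_all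
      ultimately show ?thesis by (simp flip: k_def)
    qed
    show "\<phi> x \<in> B" if "x \<in> A" for x using im that by blast
    show "the_inv_into A \<phi> y \<in> A" if "y \<in> B" for y
      using that im by (intro the_inv_into_into[OF inj]) auto
    show "the_inv_into A \<phi> (\<phi> x) = x" if "x \<in> A" for x
      by (rule the_inv_into_f_f[OF inj that])
    show "\<phi> (the_inv_into A \<phi> y) = y" if "y \<in> B" for y
      using that im by (intro f_the_inv_into_f[OF inj]) auto
  qed (rule A, rule B)
  show ?thesis by (rule multipliers_isometrically_isomorphic)
qed

section \<open>Isomorphisms of multiplier algebras\<close>

text \<open>The Pick matrix in the coordinate that moves \<open>b\<close> to 0. If
  \<open>g b = 0\<close>, all its entries in the row and the column of \<open>b\<close> are
  1.\<close>

lemma pick_positive_Moebius_form: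
  assumes B: "B \<subseteq> unit_disk" and g: "pick_positive B g" and b: "b \<in> unit_disk"
    and F: "finite F" "F \<subseteq> B"
  shows "0 \<le> Re (\<Sum>x\<in>F. \<Sum>y\<in>F. cnj (d x) * d y * ((1 - g x * cnj (g y))
    / (1 - Moebius_function 0 b x * cnj (Moebius_function 0 b y))))"
    (is "0 \<le> Re ?S")
proof -
  let ?w = "Moebius_function 0 b"
  have FD: "F \<subseteq> unit_disk" using F B by blast
  \<comment> \<open>These coefficients absorb the factors of
    \<open>one_minus_Moebius_function\<close> that depend on one point only; what remains is the
    positive constant \<open>1 - b * cnj b\<close>.\<close>
  define c where "c x = d x * (1 - b * cnj x)" for x
  have "complex_of_real ((norm (kernel_sum F c))\<^sup>2)
      - complex_of_real ((norm (kernel_sum F (\<lambda>x. c x * cnj (g x))))\<^sup>2)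
      = (\<Sum>x\<in>F. \<Sum>y\<in>F. cnj (c x) * c y * ((1 - g x * cnj (g y)) / (1 - x * cnj y)))"
    unfolding norm_kernel_sum[OF F(1) FD] sum_subtractf[symmetric]
    by (intro sum.cong refl) (simp add: algebra_simps diff_divide_distrib)
  also have "\<dots> = (\<Sum>x\<in>F. \<Sum>y\<in>F. (1 - b * cnj b) * (cnj (d x) * d y * ((1 - g x * cnj (g y))
      / (1 - ?w x * cnj (?w y)))))"
  proof (intro sum.cong refl)
    fix x y assume "x \<in> F" "y \<in> F"
    then have xy: "x \<in> unit_disk" "y \<in> unit_disk" using FD by auto
    define p q where "p = 1 - cnj b * x" and "q = 1 - b * cnj y"
    have "p \<noteq> 0" "q \<noteq> 0" "1 - x * cnj y \<noteq> 0" "1 - b * cnj b \<noteq> 0"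
      using one_minus_cnj_mult_nonzero[OF b xy(1)] one_minus_mult_cnj_nonzero[OF b xy(2)]
        one_minus_mult_cnj_nonzero[OF xy] one_minus_mult_cnj_nonzero[OF b b]
      by (simp_all add: p_def q_def)
    moreover have "1 - ?w x * cnj (?w y) = (1 - b * cnj b) * (1 - x * cnj y) / (p * q)"
      unfolding p_def q_def by (rule one_minus_Moebius_function[OF b xy])
    moreover have "cnj (c x) = cnj (d x) * p" "c y = d y * q"
      by (simp_all add: c_def p_def q_def)
    ultimately show "cnj (c x) * c y * ((1 - g x * cnj (g y)) / (1 - x * cnj y))
        = (1 - b * cnj b) * (cnj (d x) * d y * ((1 - g x * cnj (g y)) / (1 - ?w x * cnj (?w y))))"
      by simp
  qed
  also have "\<dots> = (1 - b * cnj b) * ?S"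
    by (simp only: sum_distrib_left)
  also have "1 - b * cnj b = complex_of_real (1 - (cmod b)\<^sup>2)"
    using complex_norm_square[of b] by simp
  finally have "complex_of_real ((norm (kernel_sum F c))\<^sup>2)
      - complex_of_real ((norm (kernel_sum F (\<lambda>x. c x * cnj (g x))))\<^sup>2)
      = complex_of_real (1 - (cmod b)\<^sup>2) * ?S" .
  from arg_cong[OF this, of Re]
  have "(norm (kernel_sum F c))\<^sup>2 - (norm (kernel_sum F (\<lambda>x. c x * cnj (g x))))\<^sup>2
      = (1 - (cmod b)\<^sup>2) * Re ?S"
    by (simp only: minus_complex.sel times_complex.sel Re_complex_of_real Im_complex_of_real mult_zero_left diff_zero)
  moreover have "norm (kernel_sum F (\<lambda>x. c x * cnj (g x))) \<le> norm (kernel_sum F c)"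
    using g F by (simp add: pick_positive_def)
  then have "0 \<le> (norm (kernel_sum F c))\<^sup>2 - (norm (kernel_sum F (\<lambda>x. c x * cnj (g x))))\<^sup>2"
    by (simp add: power_mono)
  ultimately have "0 \<le> (1 - (cmod b)\<^sup>2) * Re ?S" by simp
  then show ?thesis
    using norm_square_less_1_unit_disk[OF b] by (simp add: zero_le_mult_iff)
qed

lemma pick_positive_norm_le:
  assumes B: "B \<subseteq> unit_disk" and g: "pick_positive B g"
    and b: "b \<in> B" "g b = 0" and x: "x \<in> B"
  shows "cmod (g x) \<le> cmod (Moebius_function 0 b x)"
proof (cases "x = b")
  case True
  then show ?thesis using b by simp
next
  case False
  let ?w = "Moebius_function 0 b"
  have D: "b \<in> unit_disk" "x \<in> unit_disk" using B b x by auto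
  have wx: "(cmod (?w x))\<^sup>2 < 1"
    using Moebius_function_in_unit_disk[OF D, of 0] by (rule norm_square_less_1_unit_disk)
  have sq: "1 - z * cnj z = complex_of_real (1 - (cmod z)\<^sup>2)" for z
    using complex_norm_square[of z] by simp
  \<comment> \<open>All entries of the matrix at \<open>b\<close> and \<open>x\<close> are 1 except
    possibly the one at \<open>(x, x)\<close>; the vector with entries -1 and 1 isolates that entry
    minus 1.\<close>
  have "0 \<le> Re ((1 - g x * cnj (g x)) / (1 - ?w x * cnj (?w x)) - 1)"
    using pick_positive_Moebius_form[OF B g D(1), of "{b, x}" "\<lambda>y. if y = b then - 1 else 1"] False b x
    by (simp add: Moebius_function_eq_zero)
  also have "(1 - g x * cnj (g x)) / (1 - ?w x * cnj (?w x)) - 1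
      = complex_of_real ((1 - (cmod (g x))\<^sup>2) / (1 - (cmod (?w x))\<^sup>2) - 1)"
    unfolding sq by simp
  finally have "1 \<le> (1 - (cmod (g x))\<^sup>2) / (1 - (cmod (?w x))\<^sup>2)" by simp
  then have "(cmod (g x))\<^sup>2 \<le> (cmod (?w x))\<^sup>2"
    using wx by (simp add: le_divide_eq)
  then show ?thesis by (rule power2_le_imp_le) simp
qed

text \<open>Equality in the two point inequality gives a null vector of the Pick matrix at \<open>b\<close> and \<open>x\<close>.
  A null vector is orthogonal to all other points.\<close>

lemma pick_positive_extremal:
  assumes B: "B \<subseteq> unit_disk" and g: "pick_positive B g"
    and b: "b \<in> B" "g b = 0" and x: "x \<in> B" and y: "y \<in> B"
    and eq: "cmod (g x) = cmod (Moebius_function 0 b x)"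
  shows "g x * cnj (g y) = Moebius_function 0 b x * cnj (Moebius_function 0 b y)"
proof -
  let ?w = "Moebius_function 0 b"
  have D: "b \<in> unit_disk" "x \<in> unit_disk" "y \<in> unit_disk" using B b x y by auto
  consider "y = x" | "x = b" | "y = b" | "x \<noteq> b" "y \<noteq> b" "x \<noteq> y" by blast
  then show ?thesis
  proof cases
    case 1
    then show ?thesis using eq by (simp flip: complex_norm_square)
  next
    case 2
    then show ?thesis using b by (simp add: Moebius_function_eq_zero)
  next
    case 3
    then show ?thesis using b by (simp add: Moebius_function_eq_zero)
  next
    case 4
    define p where "p u v = (1 - g u * cnj (g v)) / (1 - ?w u * cnj (?w v))" for u v
    define q where "q = p x y - 1"
    have w: "?w z \<in> unit_disk" if "z \<in> unit_disk" for z
      by (rule Moebius_function_in_unit_disk[OF D(1) that])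
    have pb: "p b z = 1" "p z b = 1" for z
      by (simp_all add: p_def b Moebius_function_eq_zero)
    have pxx: "p x x = 1"
      using one_minus_mult_cnj_nonzero[OF w[OF D(2)] w[OF D(2)]] eq
      by (simp add: p_def flip: complex_norm_square)
    have pyx: "p y x = cnj (p x y)"
      by (simp add: p_def mult.commute)
    \<comment> \<open>The null vector with entries -1 at \<open>b\<close> and 1 at \<open>x\<close>
      is perturbed by \<open>t\<close> at \<open>y\<close>. The terms free of \<open>t\<close>
      cancel, and \<open>q\<close> is the coefficient of the linear one.\<close>
    have quad: "0 \<le> 2 * Re (t * q) + (cmod t)\<^sup>2 * Re (p y y)" for t
    proof -
      define d where "d z = (if z = b then - 1 else if z = x then 1 else t)" for z
      have d: "d b = - 1" "d x = 1" "d y = t" using 4 by (auto simp: d_def)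
      have "0 \<le> Re (\<Sum>u\<in>{b, x, y}. \<Sum>v\<in>{b, x, y}. cnj (d u) * d v * p u v)"
        unfolding p_def by (rule pick_positive_Moebius_form[OF B g D(1)]) (use b x y in auto)
      also have "(\<Sum>u\<in>{b, x, y}. \<Sum>v\<in>{b, x, y}. cnj (d u) * d v * p u v)
          = t * q + cnj (t * q) + t * cnj t * p y y"
        using 4 by (auto simp: d pb pxx pyx q_def algebra_simps)
      also have "Re \<dots> = 2 * Re (t * q) + (cmod t)\<^sup>2 * Re (p y y)"
        by (simp only: complex_norm_square[symmetric] plus_complex.sel cnj.sel times_complex.sel
            Re_complex_of_real Im_complex_of_real) simp
      finally show ?thesis .
    qed
    have "q = 0"
    proof (rule ccontr)
      assume q: "q \<noteq> 0"
      \<comment> \<open>So small that in the direction \<open>- cnj q\<close> the linear term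
        outweighs the quadratic one: \<open>s * Re (p y y)\<close> stays below 2.\<close>
      define s where "s = 1 / (\<bar>Re (p y y)\<bar> + 1)"
      have s: "s > 0" "s * Re (p y y) \<le> 1"
        by (auto simp: s_def divide_le_eq)
      have "- of_real s * cnj q * q = complex_of_real (- s * (cmod q)\<^sup>2)"
        unfolding mult.assoc mult.commute[of "cnj q" q] complex_norm_square[symmetric] by simp
      then have "Re (- of_real s * cnj q * q) = - s * (cmod q)\<^sup>2"
        by (simp only: Re_complex_of_real)
      moreover have "(cmod (- of_real s * cnj q))\<^sup>2 = s\<^sup>2 * (cmod q)\<^sup>2"
        by (simp add: norm_mult power_mult_distrib)
      ultimately have "0 \<le> 2 * (- s * (cmod q)\<^sup>2) + s\<^sup>2 * (cmod q)\<^sup>2 * Re (p y y)"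
        using quad[of "- of_real s * cnj q"] by simp
      also have "\<dots> = s * (cmod q)\<^sup>2 * (s * Re (p y y) - 2)"
        by (simp add: power2_eq_square algebra_simps)
      also have "\<dots> < 0"
        using s q by (intro mult_pos_neg) auto
      finally show False by simp
    qed
    then show ?thesis
      using one_minus_mult_cnj_nonzero[OF w[OF D(2)] w[OF D(3)]]
      by (simp add: q_def p_def)
  qed
qed

section \<open>Algebra isomorphisms and the point maps they induce\<close>

lemma multipliers_scale:
  assumes A: "A \<subseteq> unit_disk" and f: "f \<in> multipliers A"
  shows "(\<lambda>x\<in>A. c * f x) \<in> multipliers A"
  unfolding multipliers_def
proof (intro CollectI conjI ballI)
  fix h assume "h \<in> hardy_on A"
  then have "(\<lambda>x\<in>A. c * (\<lambda>x\<in>A. f x * h x) x) \<in> hardy_on A"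
    by (intro hardy_on_scale[OF A] multipliersD[OF f])
  also have "(\<lambda>x\<in>A. c * (\<lambda>x\<in>A. f x * h x) x) = (\<lambda>x\<in>A. (\<lambda>x\<in>A. c * f x) x * h x)"
    by (rule restrict_ext) simp
  finally show "(\<lambda>x\<in>A. (\<lambda>x\<in>A. c * f x) x * h x) \<in> hardy_on A" .
qed simp

lemma multipliers_mult:
  assumes f: "f \<in> multipliers A" and g: "g \<in> multipliers A"
  shows "(\<lambda>x\<in>A. f x * g x) \<in> multipliers A"
  unfolding multipliers_def
proof (intro CollectI conjI ballI)
  fix h assume "h \<in> hardy_on A"
  then have "(\<lambda>x\<in>A. f x * (\<lambda>x\<in>A. g x * h x) x) \<in> hardy_on A"
    by (intro multipliersD[OF f] multipliersD[OF g])
  also have "(\<lambda>x\<in>A. f x * (\<lambda>x\<in>A. g x * h x) x) = (\<lambda>x\<in>A. (\<lambda>x\<in>A. f x * g x) x * h x)"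
    by (rule restrict_ext) simp
  finally show "(\<lambda>x\<in>A. (\<lambda>x\<in>A. f x * g x) x * h x) \<in> hardy_on A" .
qed simp

text \<open>The inverse is a parameter so that each result can be applied with \<open>A\<close> and
  \<open>B\<close> exchanged.\<close>

locale multiplier_isomorphism =
  fixes A B :: "complex set" and \<Phi> \<Psi> :: "(complex \<Rightarrow> complex) \<Rightarrow> complex \<Rightarrow> complex"
  assumes A: "A \<subseteq> unit_disk" and B: "B \<subseteq> unit_disk"
    and \<Phi>: "f \<in> multipliers A \<Longrightarrow> \<Phi> f \<in> multipliers B"
    and \<Psi>: "g \<in> multipliers B \<Longrightarrow> \<Psi> g \<in> multipliers A"
    and \<Psi>\<Phi>: "f \<in> multipliers A \<Longrightarrow> \<Psi> (\<Phi> f) = f"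
    and \<Phi>\<Psi>: "g \<in> multipliers B \<Longrightarrow> \<Phi> (\<Psi> g) = g"
    and scale: "f \<in> multipliers A \<Longrightarrow> \<Phi> (\<lambda>x\<in>A. c * f x) = (\<lambda>x\<in>B. c * \<Phi> f x)"
    and mult: "f \<in> multipliers A \<Longrightarrow> f' \<in> multipliers A \<Longrightarrow>
      \<Phi> (\<lambda>x\<in>A. f x * f' x) = (\<lambda>x\<in>B. \<Phi> f x * \<Phi> f' x)"
    and norm: "f \<in> multipliers A \<Longrightarrow> multiplier_norm B (\<Phi> f) = multiplier_norm A f"
begin

lemma inverse: "multiplier_isomorphism B A \<Psi> \<Phi>"
proof
  fix g g' c assume g: "g \<in> multipliers B"
  show "\<Psi> (\<lambda>x\<in>B. c * g x) = (\<lambda>x\<in>A. c * \<Psi> g x)"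
    using \<Psi>\<Phi>[OF multipliers_scale[OF A \<Psi>[OF g], of c]] by (simp add: scale \<Psi> \<Phi>\<Psi> g)
  show "multiplier_norm A (\<Psi> g) = multiplier_norm B g"
    using norm[OF \<Psi>[OF g]] by (simp add: \<Phi>\<Psi> g)
  assume g': "g' \<in> multipliers B"
  show "\<Psi> (\<lambda>x\<in>B. g x * g' x) = (\<lambda>x\<in>A. \<Psi> g x * \<Psi> g' x)"
    using \<Psi>\<Phi>[OF multipliers_mult[OF \<Psi>[OF g] \<Psi>[OF g']]] by (simp add: mult \<Psi> \<Phi>\<Psi> g g')
qed (fact A B \<Phi> \<Psi> \<Psi>\<Phi> \<Phi>\<Psi>)+

text \<open>Over the empty set there is a single multiplier, while over a nonempty set the constants
  0 and 1 differ.\<close>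

lemma eq_empty:
  assumes "A = {}"
  shows "B = {}"
proof (rule ccontr)
  assume "B \<noteq> {}"
  then obtain b where b: "b \<in> B" by blast
  have eq: "\<Psi> (\<lambda>x\<in>B. c) = (\<lambda>_. undefined)" for c
    using multipliers_extensional[OF \<Psi>[OF const_multiplier[OF B, of c]]] assms by (auto simp: fun_eq_iff)
  have const: "(\<lambda>x\<in>B. c) = \<Phi> (\<lambda>_. undefined)" for c
    using \<Phi>\<Psi>[OF const_multiplier[OF B, of c]] unfolding eq by (rule sym)
  have "(\<lambda>x\<in>B. 0 :: complex) = (\<lambda>x\<in>B. 1)"
    using const[of 0] const[of 1] by (rule trans[OF _ sym])
  from fun_cong[OF this, of b] b show False by simp
qed

text \<open>The function \<open>point_function A a\<close> is an idempotent \<open>e\<close> with \<open>f * e\<close> a multiple of \<open>e\<close> for all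
  multipliers \<open>f\<close>. The image of \<open>e\<close> inherits this, and testing it against the identity function of
  \<open>B\<close> shows that it is supported at one point.\<close>

lemma point_function_image:
  assumes a: "a \<in> A" and e: "point_function A a \<in> multipliers A"
  obtains b where "b \<in> B" "\<Phi> (point_function A a) = point_function B b"
proof -
  define E where "E = \<Phi> (point_function A a)"
  \<comment> \<open>The candidate for the support: the coordinate function of \<open>B\<close>,
    carried to \<open>A\<close> and evaluated at \<open>a\<close>.\<close>
  define b where "b = \<Psi> (\<lambda>x\<in>B. x) a"
  have id: "(\<lambda>x\<in>B. x) \<in> multipliers B" by (rule identity_multiplier[OF B])
  have "(\<lambda>x\<in>A. point_function A a x * point_function A a x) = point_function A a"
    by (simp add: point_function_def fun_eq_iff)
  then have idem_fun: "E = (\<lambda>x\<in>B. E x * E x)"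
    using mult[OF e e] by (simp add: E_def)
  have idem: "E x = E x * E x" if "x \<in> B" for x
    by (rule trans[OF fun_cong[OF idem_fun]]) (simp add: that)
  have "(\<lambda>x\<in>A. \<Psi> (\<lambda>x\<in>B. x) x * point_function A a x) = (\<lambda>x\<in>A. b * point_function A a x)"
    by (rule restrict_ext) (simp add: point_function_def b_def)
  then have bE: "(\<lambda>x\<in>B. \<Phi> (\<Psi> (\<lambda>x\<in>B. x)) x * E x) = (\<lambda>x\<in>B. b * E x)"
    unfolding E_def mult[OF \<Psi>[OF id] e, symmetric] scale[OF e, symmetric] by simp
  have xE: "x * E x = b * E x" if "x \<in> B" for x
  proof -
    have "(\<lambda>x\<in>B. \<Phi> (\<Psi> (\<lambda>x\<in>B. x)) x * E x) x = (\<lambda>x\<in>B. b * E x) x"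
      by (rule fun_cong[OF bE])
    then show ?thesis using that by (simp add: \<Phi>\<Psi>[OF id])
  qed
  have "\<exists>x\<in>B. E x \<noteq> 0"
  proof (rule ccontr)
    assume "\<not> ?thesis"
    moreover have "E \<in> extensional B"
      unfolding E_def by (rule multipliers_extensional[OF \<Phi>[OF e]])
    \<comment> \<open>Zero is expressed as a scalar multiple so that \<open>scale\<close> and the
      injectivity of \<open>\<Phi>\<close> make the point function itself 0, against its value 1 at
      \<open>a\<close>.\<close>
    ultimately have "E = (\<lambda>x\<in>B. 0 * E x)"
      by (intro extensionalityI[of _ B]) auto
    then have "\<Phi> (point_function A a) = \<Phi> (\<lambda>x\<in>A. 0 * point_function A a x)"
      unfolding scale[OF e] by (simp add: E_def)
    then have "point_function A a = (\<lambda>x\<in>A. 0 * point_function A a x)"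
      using \<Psi>\<Phi>[OF e] \<Psi>\<Phi>[OF multipliers_scale[OF A e, of 0]] by metis
    from fun_cong[OF this, of a] a show False by (simp add: point_function_def)
  qed
  then obtain x where x: "x \<in> B" "E x \<noteq> 0" by blast
  have b: "b \<in> B" and Eb: "E b = 1"
    using xE[OF x(1)] idem[OF x(1)] x by auto
  have "E = point_function B b"
  proof (rule extensionalityI[of _ B])
    show "E \<in> extensional B"
      unfolding E_def by (rule multipliers_extensional[OF \<Phi>[OF e]])
    show "point_function B b \<in> extensional B" by (simp add: point_function_def)
    fix x assume x: "x \<in> B"
    show "E x = point_function B b x"
      using xE[OF x] Eb x by (cases "x = b") (auto simp: point_function_def)
  qed
  then show thesis using that[OF b] by (simp add: E_def)
qed

text \<open>The product of \<open>f\<close> with the point function is \<open>f a\<close> times the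
  point function. Apply \<open>\<Phi>\<close> and evaluate at the support \<open>b\<close> of the
  image.\<close>

lemma point_evaluation:
  assumes hull: "hardy_hull A = A" and AD: "A \<noteq> unit_disk" and a: "a \<in> A"
  obtains b where "b \<in> B" "point_function B b \<in> multipliers B"
    "\<And>f. f \<in> multipliers A \<Longrightarrow> \<Phi> f b = f a"
proof -
  have e: "point_function A a \<in> multipliers A"
    by (rule point_function_multiplier[OF A AD hull a])
  obtain b where b: "b \<in> B" "\<Phi> (point_function A a) = point_function B b"
    using point_function_image[OF a e] .
  show thesis
  proof (rule that[OF b(1)])
    show "point_function B b \<in> multipliers B"
      using \<Phi>[OF e] by (simp add: b(2))
    fix f assume f: "f \<in> multipliers A"
    have "(\<lambda>x\<in>A. f x * point_function A a x) = (\<lambda>x\<in>A. f a * point_function A a x)"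
      by (rule restrict_ext) (simp add: point_function_def)
    then have "(\<lambda>x\<in>B. \<Phi> f x * point_function B b x) = (\<lambda>x\<in>B. f a * point_function B b x)"
      unfolding b(2)[symmetric] mult[OF f e, symmetric] scale[OF e, symmetric] by simp
    from fun_cong[OF this, of b] show "\<Phi> f b = f a"
      using b(1) by (simp add: point_function_def)
  qed
qed

text \<open>For a proper subset \<open>A\<close> a point function would be carried to a point
  function on the disk, which is never a multiplier there.\<close>

lemma image_eq_unit_disk:
  assumes hull: "hardy_hull A = A" and BD: "B = unit_disk"
  shows "A = unit_disk"
proof (rule ccontr)
  assume AD: "A \<noteq> unit_disk"
  have "A \<noteq> {}" using eq_empty BD by auto
  then obtain a where "a \<in> A" by blast
  then obtain b where "b \<in> B" "point_function B b \<in> multipliers B"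
    using point_evaluation[OF hull AD] by metis
  then show False
    using point_function_not_multiplier_unit_disk BD by simp
qed

lemma Moebius_function_pick_positive:
  assumes "a \<in> A"
  shows "pick_positive B (\<Phi> (restrict (Moebius_function 0 a) A))"
proof -
  have a: "a \<in> unit_disk" using assms A by blast
  show ?thesis
    using Moebius_function_contractive_multiplier[OF A a] norm[of "restrict (Moebius_function 0 a) A"]
    by (intro contractive_multiplier_pick_positive[OF B] \<Phi>) auto
qed

text \<open>The image of the Moebius function at \<open>a\<close> vanishes at
  \<open>\<alpha> a\<close>, so the two point inequality bounds it. Thus \<open>\<alpha>\<close>
  does not shrink pseudohyperbolic distances; the same for the inverse will make it an
  isometry.\<close>

lemma Moebius_function_norm_le:
  assumes \<alpha>: "\<And>x. x \<in> A \<Longrightarrow> \<alpha> x \<in> B" "\<And>x f. x \<in> A \<Longrightarrow> f \<in> multipliers A \<Longrightarrow> \<Phi> f (\<alpha> x) = f x"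
    and a: "a \<in> A" and x: "x \<in> A"
  shows "cmod (Moebius_function 0 a x) \<le> cmod (Moebius_function 0 (\<alpha> a) (\<alpha> x))"
proof -
  define f where "f = restrict (Moebius_function 0 a) A"
  have "a \<in> unit_disk" using a A by blast
  then have f: "f \<in> multipliers A"
    unfolding f_def by (rule Moebius_function_contractive_multiplier(1)[OF A])
  have "\<Phi> f (\<alpha> y) = Moebius_function 0 a y" if "y \<in> A" for y
    using \<alpha>(2)[OF that f] that by (simp add: f_def)
  moreover have "pick_positive B (\<Phi> f)"
    unfolding f_def by (rule Moebius_function_pick_positive[OF a])
  ultimately show ?thesis
    using pick_positive_norm_le[OF B, of "\<Phi> f" "\<alpha> a" "\<alpha> x"] \<alpha>(1) a x
    by (simp add: Moebius_function_eq_zero)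
qed

lemma congruent:
  assumes hull: "hardy_hull A = A" "hardy_hull B = B"
  shows "congruent_in_disk A B"
proof -
  interpret inv: multiplier_isomorphism B A \<Psi> \<Phi> by (rule inverse)
  have aut_id: "disk_automorphism (\<lambda>z. z)"
    by (rule disk_automorphismI[where \<psi> = "\<lambda>z. z"]) (auto intro: holomorphic_intros)
  \<comment> \<open>If \<open>A\<close> is empty or one of the sets is the whole disk, both
    coincide; otherwise points can be transported in both directions.\<close>
  consider "A = B" | "A \<noteq> unit_disk" "B \<noteq> unit_disk" "A \<noteq> {}"
    using eq_empty image_eq_unit_disk[OF hull(1)] inv.image_eq_unit_disk[OF hull(2)] by blast
  then show ?thesis
  proof cases
    case 1
    then show ?thesis using aut_id by (auto simp: congruent_in_disk_def)
  next
    case 2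
    have "\<exists>b\<in>B. \<forall>f\<in>multipliers A. \<Phi> f b = f a" if "a \<in> A" for a
      using point_evaluation[OF hull(1) 2(1) that] by metis
    then obtain \<alpha> where \<alpha>: "\<And>a. a \<in> A \<Longrightarrow> \<alpha> a \<in> B"
      "\<And>a f. a \<in> A \<Longrightarrow> f \<in> multipliers A \<Longrightarrow> \<Phi> f (\<alpha> a) = f a" by metis
    have "\<exists>a\<in>A. \<forall>g\<in>multipliers B. \<Psi> g a = g b" if "b \<in> B" for b
      using inv.point_evaluation[OF hull(2) 2(2) that] by metis
    then obtain \<beta> where \<beta>: "\<And>b. b \<in> B \<Longrightarrow> \<beta> b \<in> A"
      "\<And>b g. b \<in> B \<Longrightarrow> g \<in> multipliers B \<Longrightarrow> \<Psi> g (\<beta> b) = g b" by metis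
    \<comment> \<open>Tested on the coordinate function, which separates points.\<close>
    have \<beta>\<alpha>: "\<beta> (\<alpha> a) = a" if a: "a \<in> A" for a
    proof -
      have id: "(\<lambda>x\<in>A. x) \<in> multipliers A" by (rule identity_multiplier[OF A])
      have "\<beta> (\<alpha> a) = \<Psi> (\<Phi> (\<lambda>x\<in>A. x)) (\<beta> (\<alpha> a))"
        using \<beta>(1)[OF \<alpha>(1)[OF a]] by (simp add: \<Psi>\<Phi>[OF id])
      also have "\<dots> = a"
        using \<beta>(2)[OF \<alpha>(1)[OF a] \<Phi>[OF id]] \<alpha>(2)[OF a id] a by simp
      finally show ?thesis .
    qed
    have \<alpha>\<beta>: "\<alpha> (\<beta> b) = b" if b: "b \<in> B" for b
    proof -
      have id: "(\<lambda>x\<in>B. x) \<in> multipliers B" by (rule identity_multiplier[OF B])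
      have "\<alpha> (\<beta> b) = \<Phi> (\<Psi> (\<lambda>x\<in>B. x)) (\<alpha> (\<beta> b))"
        using \<alpha>(1)[OF \<beta>(1)[OF b]] by (simp add: \<Phi>\<Psi>[OF id])
      also have "\<dots> = b"
        using \<alpha>(2)[OF \<beta>(1)[OF b] \<Psi>[OF id]] \<beta>(2)[OF b id] b by simp
      finally show ?thesis .
    qed
    obtain a where a: "a \<in> A" using 2 by blast
    define b where "b = \<alpha> a"
    have b: "b \<in> B" using \<alpha>(1)[OF a] by (simp add: b_def)
    have aD: "a \<in> unit_disk" and bD: "b \<in> unit_disk" "- b \<in> unit_disk" using a b A B by auto
    define f where "f = restrict (Moebius_function 0 a) A"
    have f: "f \<in> multipliers A"
      unfolding f_def by (rule Moebius_function_contractive_multiplier(1)[OF A aD])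
    have f\<alpha>: "\<Phi> f (\<alpha> x) = Moebius_function 0 a x" if "x \<in> A" for x
      using \<alpha>(2)[OF that f] that by (simp add: f_def)
    have pos: "pick_positive B (\<Phi> f)"
      unfolding f_def by (rule Moebius_function_pick_positive[OF a])
    have fb: "\<Phi> f b = 0" unfolding b_def f\<alpha>[OF a] by (rule Moebius_function_eq_zero)
    have norm_eq: "cmod (\<Phi> f (\<alpha> x)) = cmod (Moebius_function 0 b (\<alpha> x))" if x: "x \<in> A" for x
      unfolding f\<alpha>[OF x] b_def
    proof (rule antisym)
      show "cmod (Moebius_function 0 a x) \<le> cmod (Moebius_function 0 (\<alpha> a) (\<alpha> x))"
        by (rule Moebius_function_norm_le[OF \<alpha> a x])
      show "cmod (Moebius_function 0 (\<alpha> a) (\<alpha> x)) \<le> cmod (Moebius_function 0 a x)"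
        using inv.Moebius_function_norm_le[OF \<beta> \<alpha>(1)[OF a] \<alpha>(1)[OF x]] by (simp add: \<beta>\<alpha> a x)
    qed
    have "\<exists>r. cmod r = 1 \<and> (\<forall>x\<in>A. Moebius_function 0 b (\<alpha> x) = r * Moebius_function 0 a x)"
    \<comment> \<open>The constant \<open>r\<close> is read off at a second point of
      \<open>A\<close>; if there is none, both sides are 0 and 1 serves.\<close>
    proof (cases "A = {a}")
      case True
      then show ?thesis
        by (intro exI[of _ 1]) (simp add: Moebius_function_eq_zero b_def)
    next
      case False
      then obtain y where y: "y \<in> A" "y \<noteq> a" using a by blast
      define v where "v = Moebius_function 0 b (\<alpha> y)"
      define u where "u = Moebius_function 0 a y"
      have yD: "y \<in> unit_disk" using y A by blast
      have "u \<noteq> 0" using Moebius_function_eq_0_iff[OF aD yD] y by (simp add: u_def)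
      moreover have uv: "cmod u = cmod v"
        using norm_eq[OF y(1)] by (simp add: f\<alpha> y u_def v_def)
      ultimately have v: "v \<noteq> 0" by auto
      \<comment> \<open>The extremal identity at \<open>\<alpha> x\<close> and the fixed point
        \<open>\<alpha> y\<close> gives a ratio independent of \<open>x\<close>.\<close>
      have "Moebius_function 0 b (\<alpha> x) = cnj (u / v) * Moebius_function 0 a x" if x: "x \<in> A" for x
      proof -
        have "\<Phi> f (\<alpha> x) * cnj (\<Phi> f (\<alpha> y)) = Moebius_function 0 b (\<alpha> x) * cnj v"
          unfolding v_def by (rule pick_positive_extremal[OF B pos b fb \<alpha>(1)[OF x] \<alpha>(1)[OF y(1)] norm_eq[OF x]])
        then have "Moebius_function 0 a x * cnj u = Moebius_function 0 b (\<alpha> x) * cnj v"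
          by (simp add: f\<alpha> x y u_def)
        then show ?thesis using v by (simp add: field_simps)
      qed
      then show ?thesis
        using uv v by (intro exI[of _ "cnj (u / v)"]) (auto simp: norm_divide)
    qed
    then obtain r where r: "cmod r = 1"
      and r\<alpha>: "\<And>x. x \<in> A \<Longrightarrow> Moebius_function 0 b (\<alpha> x) = r * Moebius_function 0 a x" by blast
    have rot: "s * z \<in> unit_disk" if "cmod s = 1" "z \<in> unit_disk" for s z
      using that by (simp add: norm_mult)
    have rr: "cmod (cnj r) = 1" "r * (cnj r * z) = z" "cnj r * (r * z) = z" for z
      using r complex_norm_square[of r] by (simp_all add: mult.commute flip: mult.assoc)
    have aD': "- a \<in> unit_disk" using aD by simp
    have holM: "Moebius_function 0 w holomorphic_on unit_disk" if "w \<in> unit_disk" for w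
      by (rule Moebius_function_holomorphic) (use that in simp)
    have mapM: "Moebius_function 0 w z \<in> unit_disk" if "w \<in> unit_disk" "z \<in> unit_disk" for w z
      using that by (rule Moebius_function_in_unit_disk)
    have hol: "(\<lambda>z. Moebius_function 0 w (s * Moebius_function 0 w' z)) holomorphic_on unit_disk"
      if "w \<in> unit_disk" "w' \<in> unit_disk" "cmod s = 1" for w w' s
    proof -
      have "(\<lambda>z. s * Moebius_function 0 w' z) holomorphic_on unit_disk"
        by (intro holomorphic_intros holM that)
      from holomorphic_on_compose_gen[OF this holM[OF that(1)]]
      show ?thesis using rot[OF that(3) mapM[OF that(2)]] by (auto simp: o_def image_subset_iff)
    qed
    \<comment> \<open>The relation \<open>r\<alpha>\<close> solved for \<open>\<alpha> x\<close>;
      the formula extends \<open>\<alpha>\<close> to the whole disk.\<close>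
    define \<phi> where "\<phi> z = Moebius_function 0 (- b) (r * Moebius_function 0 a z)" for z
    define \<psi> where "\<psi> z = Moebius_function 0 (- a) (cnj r * Moebius_function 0 b z)" for z
    have "disk_automorphism \<phi>"
    proof (rule disk_automorphismI[where \<psi> = \<psi>])
      show "\<phi> holomorphic_on unit_disk" "\<psi> holomorphic_on unit_disk"
        unfolding \<phi>_def \<psi>_def by (rule hol; fact)+
      fix z :: complex assume z: "z \<in> unit_disk"
      have 1: "r * Moebius_function 0 a z \<in> unit_disk" by (rule rot[OF r mapM[OF aD z]])
      have 2: "cnj r * Moebius_function 0 b z \<in> unit_disk" by (rule rot[OF rr(1) mapM[OF bD(1) z]])
      show "\<phi> z \<in> unit_disk" "\<psi> z \<in> unit_disk"
        unfolding \<phi>_def \<psi>_def by (rule mapM[OF bD(2) 1], rule mapM[OF aD' 2])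
      show "\<psi> (\<phi> z) = z" "\<phi> (\<psi> z) = z"
        unfolding \<phi>_def \<psi>_def Moebius_function_inverse(2)[OF bD(1) 1] Moebius_function_inverse(2)[OF aD 2]
          rr(2,3) Moebius_function_inverse(1)[OF aD z] Moebius_function_inverse(1)[OF bD(1) z]
        by (rule refl)+
    qed
    moreover have "\<phi> x = \<alpha> x" if x: "x \<in> A" for x
    proof -
      have "\<alpha> x \<in> unit_disk" using \<alpha>(1)[OF x] B by blast
      then show ?thesis
        unfolding \<phi>_def r\<alpha>[OF x, symmetric] by (rule Moebius_function_inverse(1)[OF bD(1)])
    qed
    then have "\<phi> ` A = B"
      using \<alpha>(1) \<beta>(1) \<alpha>\<beta> by (force simp: image_iff)
    ultimately show ?thesis unfolding congruent_in_disk_def by blast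
  qed
qed

end

theorem theorem1p6:
  fixes A B :: "complex set"
  assumes "A \<subseteq> unit_disk" and "B \<subseteq> unit_disk"
    and "hardy_hull A = A" and "hardy_hull B = B"
  shows "multipliers_isometrically_isomorphic A B \<longleftrightarrow> congruent_in_disk A B"
proof
  assume "multipliers_isometrically_isomorphic A B"
  then obtain \<Phi> where \<Phi>: "bij_betw \<Phi> (multipliers A) (multipliers B)"
    "\<And>c f. f \<in> multipliers A \<Longrightarrow> \<Phi> (\<lambda>x\<in>A. c * f x) = (\<lambda>x\<in>B. c * \<Phi> f x)"
    "\<And>f g. f \<in> multipliers A \<Longrightarrow> g \<in> multipliers A \<Longrightarrow>
      \<Phi> (\<lambda>x\<in>A. f x * g x) = (\<lambda>x\<in>B. \<Phi> f x * \<Phi> g x)"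
    "\<And>f. f \<in> multipliers A \<Longrightarrow> multiplier_norm B (\<Phi> f) = multiplier_norm A f"
    unfolding multipliers_isometrically_isomorphic_def by blast
  interpret multiplier_isomorphism A B \<Phi> "the_inv_into (multipliers A) \<Phi>"
  proof
    show "\<Phi> f \<in> multipliers B" if "f \<in> multipliers A" for f
      by (rule bij_betw_apply[OF \<Phi>(1) that])
    show "the_inv_into (multipliers A) \<Phi> g \<in> multipliers A" if "g \<in> multipliers B" for g
      by (rule bij_betw_apply[OF bij_betw_the_inv_into[OF \<Phi>(1)] that])
    show "the_inv_into (multipliers A) \<Phi> (\<Phi> f) = f" if "f \<in> multipliers A" for f
      by (rule the_inv_into_f_f[OF bij_betw_imp_inj_on[OF \<Phi>(1)] that])
    show "\<Phi> (the_inv_into (multipliers A) \<Phi> g) = g" if "g \<in> multipliers B" for g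
      by (rule f_the_inv_into_f_bij_betw[OF \<Phi>(1) that])
  qed (fact assms \<Phi>)+
  show "congruent_in_disk A B" by (rule congruent) fact+
next
  assume "congruent_in_disk A B"
  then show "multipliers_isometrically_isomorphic A B"
    by (rule congruent_imp_isometrically_isomorphic[OF assms(1,2)])
qed

end
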